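(* Let $\psi:\mathbb{R}^+\to\mathbb{R}^+$ be a positive function (not assumed monotonic). Let $f$ be a dimension function such that the function $r\mapsto r^{-\gamma}f(r)$ is monotonic, where $\gamma=\frac{\log 2}{\log 3}$. Then $$\mathcal{H}^f(W_{\mathcal{A}}(\psi)\cap K)=\begin{cases}0 & \text{if } \displaystyle\sum_{n=1}^{\infty} f(\psi(3^n))\,(3^n)^{\gamma}<\infty,\\[2ex] \mathcal{H}^f(K) & \text{if } \displaystyle\sum_{n=1}^{\infty} f(\psi(3^n))\,(3^n)^{\gamma}=\infty.\end{cases}$$
   Context: $K\subset[0,1]$ is the standard middle third Cantor set, and $\gamma:=\log 2/\log 3$ is its Hausdorff dimension. $\mathcal{A}:=\{3^n : n=0,1,2,\ldots\}$. For $\psi:\mathbb{R}^+\to\mathbb{R}^+$, where $\mathbb{R}^+$ denotes the positive reals, $$W_{\mathcal{A}}(\psi):=\{x\in[0,1] : |x-p/q|<\psi(q)\text{ for infinitely many }(p,q)\in\mathbb{Z}\times\mathcal{A}\}.$$ A dimension function is a monotonic, non-decreasing function $f:\mathbb{R}^+\to\mathbb{R}^+$ with $f(r)\to0$ as $r\to0$. For $F\subset\mathbb{R}$ and $\rho>0$, a $\rho$-cover of $F$ is a countable collection of balls $\{B_i\}$ with radii $r(B_i)\le\rho$ and $F\subset\bigcup_i B_i$. Put $\mathcal{H}^f_\rho(F):=\inf\sum_i f(r(B_i))$, the infimum being over all $\rho$-covers of $F$. The Hausdorff $f$-measure is $\mathcal{H}^f(F):=\lim_{\rho\to0}\mathcal{H}^f_\rho(F)=\sup_{\rho>0}\mathcal{H}^f_\rho(F)$,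 which may be $+\infty$. *)

theory Defs
  imports "HOL-Analysis.Analysis"
begin

text \<open>The union of the intervals of length 1/3^n left after n removals of open middle thirds,
  generated by the two similarities of ratio 1/3 that fix 0 and 1.\<close>

fun cantor_level :: "nat \<Rightarrow> real set" where
  "cantor_level 0 = {0..1}"
| "cantor_level (Suc n) = (\<lambda>x. x / 3) ` cantor_level n \<union> (\<lambda>x. (x + 2) / 3) ` cantor_level n"

definition cantor_set :: "real set" where
  "cantor_set = (\<Inter>n. cantor_level n)"

definition cantor_dim :: real where
  "cantor_dim = ln 2 / ln 3"

definition powers_of_3 :: "nat set" where
  "powers_of_3 = range (\<lambda>n. 3 ^ n)"

definition W :: "nat set \<Rightarrow> (real \<Rightarrow> real) \<Rightarrow> real set" where
  "W A \<psi> = {x \<in> {0..1}.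
     infinite {(p :: int, q :: nat). q \<in> A \<and> \<bar>x - real_of_int p / real q\<bar> < \<psi> (real q)}}"

text \<open>Functions on the positive reals are represented by total functions on the reals; values
  at non-positive arguments are irrelevant.\<close>

definition dimension_function :: "(real \<Rightarrow> real) \<Rightarrow> bool" where
  "dimension_function f \<longleftrightarrow>
     (\<forall>r>0. f r > 0) \<and> mono_on {0<..} f \<and> (f \<longlongrightarrow> 0) (at_right 0)"

text \<open>A ball of positive radius in the real line determines its centre and radius, so a
  collection of balls is represented by the set of its (centre, radius) pairs. Finite
  collections are allowed.\<close>

definition rho_cover :: "real \<Rightarrow> real set \<Rightarrow> (real \<times> real) set \<Rightarrow> bool" where
  "rho_cover \<rho> F \<B> \<longleftrightarrow>
     countable \<B> \<and> (\<forall>(c, r) \<in> \<B>. 0 < r \<and> r \<le> \<rho>) \<and> F \<subseteq> (\<Union>(c, r) \<in> \<B>. ball c r)"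

definition hausdorff_premeasure :: "(real \<Rightarrow> real) \<Rightarrow> real \<Rightarrow> real set \<Rightarrow> ennreal" where
  "hausdorff_premeasure f \<rho> F =
     (INF \<B> \<in> {\<B>. rho_cover \<rho> F \<B>}. \<Sum>\<^sub>\<infinity>(c, r) \<in> \<B>. ennreal (f r))"

definition hausdorff_measure :: "(real \<Rightarrow> real) \<Rightarrow> real set \<Rightarrow> ennreal" where
  "hausdorff_measure f F = (SUP \<rho> \<in> {0<..}. hausdorff_premeasure f \<rho> F)"

end

theory Submission
  imports Defs "HOL-Library.Sublist"
begin

text \<open>Code the level \<open>n\<close> intervals of the Cantor set by binary words of length \<open>n\<close>. If \<open>t n\<close> is the
  least \<open>m \<ge> n\<close> with \<open>3\<^sup>-\<^sup>m < \<psi>(3\<^sup>n)\<close>, then every point whose digits after the \<open>n\<close>-th up to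
  the \<open>t n\<close>-th vanish is \<open>\<psi>(3\<^sup>n)\<close>-close to a triadic rational of level \<open>n\<close>; call a word of length
  \<open>t n\<close> a target of generation \<open>n\<close> if moreover its \<open>n\<close>-th digit is nonzero.

  If \<open>\<Sum> 2\<^sup>n / 2\<^sup>t\<^sup>(\<^sup>n\<^sup>)\<close> diverges, then finitely many generations of targets fill a fixed
  proportion of any cylinder; iterating in what is left over shows that the points of \<open>K\<close> hit only
  finitely often form a null set. When \<open>f(r) = O(r\<^sup>\<gamma>)\<close> along \<open>r = 3\<^sup>-\<^sup>k\<close> this settles the
  divergence case.

  Otherwise \<open>f(r) / r\<^sup>\<gamma>\<close> increases to infinity as \<open>r \<rightarrow> 0\<close>, and it suffices that a family of
  cylinders that is cheap relative to a cylinder \<open>v\<close> cannot cover the points of \<open>v\<close> that are hit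
  infinitely often. One builds a decreasing sequence of targets inside \<open>v\<close>, relative to each of which
  the family is still cheap: the targets swallowed by a member of the family and those in which the
  family is expensive together carry less than the available mass. The limit point is not covered.\<close>

section \<open>Cylinders of the Cantor set\<close>

text \<open>The ternary digits 0 and 2 are coded by \<open>False\<close> and \<open>True\<close>;
  the integer read off is the numerator, over \<open>3 ^ length w\<close>, of the left endpoint of
  the cylinder.\<close>

fun word_num :: "bool list \<Rightarrow> int" where
  "word_num [] = 0"
| "word_num (b # w) = (if b then 2 * 3 ^ length w else 0) + word_num w"

definition cyl :: "bool list \<Rightarrow> real set" where
  "cyl w = {real_of_int (word_num w) / 3 ^ length w .. (real_of_int (word_num w) + 1) / 3 ^ length w}"



lemma word_num_append: "word_num (u @ w) = word_num u * 3 ^ length w + word_num w"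
  by (induction u) (auto simp: power_add algebra_simps)

lemma word_num_replicate_False [simp]: "word_num (replicate m False) = 0"
  by (induction m) auto

lemma cyl_Nil [simp]: "cyl [] = {0..1}"
  by (simp add: cyl_def)

lemma cyl_Cons: "x \<in> cyl (b # w) \<longleftrightarrow> 3 * x - (if b then 2 else 0) \<in> cyl w"
  by (auto simp: cyl_def field_simps)

lemma cyl_subset_unit: "cyl w \<subseteq> {0..1}"
proof (induction w)
  case (Cons b w)
  show ?case
  proof
    fix x assume "x \<in> cyl (b # w)"
    then have "3 * x - (if b then 2 else 0) \<in> {0..1}"
      using Cons cyl_Cons by blast
    then show "x \<in> {0..1}" by (auto split: if_splits)
  qed
qed simp

lemma cyl_append_subset: "cyl (u @ w) \<subseteq> cyl u"
proof (induction u)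
  case Nil
  then show ?case using cyl_subset_unit by simp
next
  case (Cons b u)
  then show ?case by (auto simp: cyl_Cons)
qed

lemma cyl_prefix_subset: "prefix u w \<Longrightarrow> cyl w \<subseteq> cyl u"
  by (auto simp: prefix_def dest: subsetD[OF cyl_append_subset])

text \<open>Cylinders of one level are pairwise disjoint even as closed intervals, because the
  removed middle third separates siblings: \<open>3 * x\<close> and \<open>3 * x - 2\<close> cannot
  both lie in the unit interval.\<close>

lemma cyl_eq_length:
  assumes "length u = length w" "x \<in> cyl u" "x \<in> cyl w"
  shows "u = w"
  using assms
proof (induction u w arbitrary: x rule: list_induct2)
  case (Cons b u c w)
  have "3 * x - (if b then 2 else 0) \<in> {0..1}" "3 * x - (if c then 2 else 0) \<in> {0..1}"
    using Cons.prems cyl_Cons cyl_subset_unit by blast+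
  then have "b = c" by (auto split: if_splits)
  with Cons show ?case by (auto simp: cyl_Cons)
qed simp

lemma cyl_imp_prefix:
  assumes "x \<in> cyl u" "x \<in> cyl w" "length u \<le> length w"
  shows "prefix u w"
proof -
  have "x \<in> cyl (take (length u) w)"
    using assms(2) cyl_prefix_subset[OF take_is_prefix] by blast
  then have "u = take (length u) w"
    using assms by (intro cyl_eq_length) auto
  then show ?thesis by (metis take_is_prefix)
qed

lemma cantor_level_eq: "cantor_level n = (\<Union>w\<in>{w. length w = n}. cyl w)"
proof (induction n)
  case (Suc n)
  have 1: "x \<in> cantor_level (Suc n) \<longleftrightarrow> 3 * x \<in> cantor_level n \<or> 3 * x - 2 \<in> cantor_level n" for x
  proof
    assume "x \<in> cantor_level (Suc n)"
    then obtain y where "y \<in> cantor_level n" "x = y / 3 \<or> x = (y + 2) / 3" by auto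
    moreover from this have "y = 3 * x \<or> y = 3 * x - 2" by auto
    ultimately show "3 * x \<in> cantor_level n \<or> 3 * x - 2 \<in> cantor_level n" by auto
  next
    assume "3 * x \<in> cantor_level n \<or> 3 * x - 2 \<in> cantor_level n"
    moreover have "x = 3 * x / 3" "x = (3 * x - 2 + 2) / 3" by simp_all
    ultimately show "x \<in> cantor_level (Suc n)" unfolding cantor_level.simps by blast
  qed
  have 2: "x \<in> (\<Union>w\<in>{w. length w = Suc n}. cyl w) \<longleftrightarrow>
      (\<exists>b w. length w = n \<and> x \<in> cyl (b # w))" for x
    by (auto simp: length_Suc_conv)
  show ?case
  proof (rule set_eqI)
    fix x
    show "x \<in> cantor_level (Suc n) \<longleftrightarrow> x \<in> (\<Union>w\<in>{w. length w = Suc n}. cyl w)"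
      unfolding 1 2 Suc ex_bool_eq cyl_Cons by auto
  qed
qed simp

lemma cantor_set_iff: "x \<in> cantor_set \<longleftrightarrow> (\<forall>n. \<exists>w. length w = n \<and> x \<in> cyl w)"
  by (auto simp: cantor_set_def cantor_level_eq)

text \<open>Nested nonempty compact intervals have a common point. It lies in level \<open>n\<close>
  because the truncation of \<open>v n\<close> to length \<open>n\<close> is a word whose cylinder
  contains it.\<close>

lemma cantor_set_prefix_chain:
  assumes "\<And>i. prefix (v i) (v (Suc i))" "\<And>i. i \<le> length (v i)"
  obtains x where "x \<in> cantor_set" "\<And>i. x \<in> cyl (v i)"
proof -
  have "(\<Inter>i. cyl (v i)) \<noteq> {}"
  proof (rule compact_nest)
    show "compact (cyl (v i))" for i by (simp add: cyl_def)
    show "cyl (v i) \<noteq> {}" for i by (simp add: cyl_def divide_right_mono)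
    show "cyl (v n) \<subseteq> cyl (v m)" if "m \<le> n" for m n
      using lift_Suc_antimono_le[of "\<lambda>i. cyl (v i)"] assms(1) that cyl_prefix_subset by blast
  qed
  then obtain x where x: "\<And>i. x \<in> cyl (v i)" by blast
  have "x \<in> cantor_set"
    unfolding cantor_set_iff
  proof
    fix n
    have "x \<in> cyl (take n (v n))"
      using x[of n] cyl_prefix_subset[OF take_is_prefix] by blast
    then show "\<exists>w. length w = n \<and> x \<in> cyl w"
      using assms(2)[of n] by (intro exI[of _ "take n (v n)"]) auto
  qed
  with x that show ?thesis by blast
qed

section \<open>Counting words and targets\<close>

lemma card_extensions:
  "card {w :: bool list. length w = length v + m \<and> prefix v w} = 2 ^ m"
proof -
  have "{w. length w = length v + m \<and> prefix v w} = (@) v ` {u :: bool list. length u = m}"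
    by (auto simp: prefix_def)
  moreover have "inj_on ((@) v) {u :: bool list. length u = m}"
    by (simp add: inj_on_def)
  moreover have "card {u :: bool list. length u = m} = 2 ^ m"
    using card_lists_length_eq[of "UNIV :: bool set" m] by simp
  ultimately show ?thesis by (simp add: card_image)
qed

lemma finite_words: "finite {w :: bool list. length w = n}"
  using finite_lists_length_eq[of "UNIV :: bool set" n] by simp

text \<open>The condition \<open>w \<noteq> []\<close> keeps out the unspecified
  \<open>last []\<close>, so generation 0 has no targets. The mark \<open>last w\<close> halves the
  number of targets and in return controls how targets of different generations are nested.\<close>

definition target :: "(nat \<Rightarrow> nat) \<Rightarrow> nat \<Rightarrow> bool list set" where
  "target t n = {w @ replicate (t n - n) False |w. length w = n \<and> w \<noteq> [] \<and> last w}"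

lemma finite_target: "finite (target t n)"
proof (rule finite_subset)
  show "target t n \<subseteq> (\<lambda>w. w @ replicate (t n - n) False) ` {w. length w = n}"
    by (auto simp: target_def)
qed (simp add: finite_words)

lemma length_target: "D \<in> target t n \<Longrightarrow> n \<le> t n \<Longrightarrow> length D = t n"
  by (auto simp: target_def)

text \<open>The run of zeros leaves the left endpoint given by the first \<open>n\<close> digits in
  place, so the cylinder of \<open>D\<close> is an interval of length \<open>(1/3) ^ t n\<close>
  that starts at a fraction with denominator \<open>3 ^ n\<close>.\<close>

lemma target_close:
  assumes "D \<in> target t n" "n \<le> t n" "x \<in> cyl D"
  shows "\<exists>p::int. \<bar>x - p / 3 ^ n\<bar> \<le> (1/3) ^ t n"
proof -
  obtain w where w: "D = w @ replicate (t n - n) False" "length w = n"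
    using assms by (auto simp: target_def)
  have "(3::real) ^ t n = 3 ^ n * 3 ^ (t n - n)"
    using assms(2) by (metis le_add_diff_inverse power_add)
  then have "x \<ge> real_of_int (word_num w) / 3 ^ n"
     "x \<le> real_of_int (word_num w) / 3 ^ n + (1/3) ^ t n"
    using assms(2,3) w by (auto simp: cyl_def word_num_append field_simps)
  then show ?thesis by (intro exI[of _ "word_num w"]) auto
qed

lemma nth_target_True: "D \<in> target t n \<Longrightarrow> 0 < n \<and> D ! (n - 1)"
  by (auto simp: target_def nth_append last_conv_nth)

lemma nth_target_False: "D \<in> target t n \<Longrightarrow> n \<le> i \<Longrightarrow> i < t n \<Longrightarrow> \<not> D ! i"
  by (auto simp: target_def nth_append)

text \<open>A target of generation \<open>n\<close> is determined by its first \<open>n\<close>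
  digits, and both targets take these from \<open>A\<close>.\<close>

lemma target_eqI:
  assumes "D \<in> target t n" "D' \<in> target t n" "n \<le> length A" "prefix A D" "prefix A D'"
  shows "D = D'"
proof -
  have "take n D = take n A" "take n D' = take n A"
    using assms by (auto simp: prefix_def)
  then show ?thesis using assms(1,2) by (auto simp: target_def)
qed

lemma prefix_nth: "prefix u w \<Longrightarrow> i < length u \<Longrightarrow> u ! i = w ! i"
  by (auto simp: prefix_def nth_append)

text \<open>The mark \<open>True\<close> at position \<open>n\<close> in front of the run of zeros makes targets of
  different generations nested only if the earlier run has already ended.\<close>

lemma target_prefix_imp_less:
  assumes "D' \<in> target t j" "D \<in> target t n" "j < n" "j \<le> t j" "prefix D' D"
  shows "t j < n"
proof (rule ccontr)
  assume "\<not> t j < n"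
  have *: "j \<le> n - 1" using assms(3) by linarith
  have "n - 1 < t j" using nth_target_True[OF assms(2)] \<open>\<not> t j < n\<close> by linarith
  moreover have "D' ! (n - 1) = D ! (n - 1)"
    using assms \<open>n - 1 < t j\<close> length_target by (intro prefix_nth) auto
  ultimately show False
    using nth_target_True[OF assms(2)] nth_target_False[OF assms(1) *] \<open>n - 1 < t j\<close> by blast
qed

text \<open>The mark excludes the other order as well: as a prefix, \<open>D\<close> would have
  length \<open>t n \<le> t j\<close>, so its mark at index \<open>n - 1\<close> would fall into the
  zeros of \<open>D'\<close>.\<close>

lemma target_not_prefix_earlier:
  assumes "D' \<in> target t j" "D \<in> target t n" "j < n" "j \<le> t j" "n \<le> t n"
  shows "\<not> prefix D D'"
proof
  assume pre: "prefix D D'"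
  have *: "j \<le> n - 1" using assms(3) by linarith
  have "t n \<le> t j" using assms length_target prefix_length_le pre by metis
  then have "n - 1 < t j" "n - 1 < t n" using nth_target_True[OF assms(2)] assms by linarith+
  moreover have "D ! (n - 1) = D' ! (n - 1)"
    using assms \<open>n - 1 < t n\<close> length_target pre by (intro prefix_nth) auto
  ultimately show False
    using nth_target_True[OF assms(2)] nth_target_False[OF assms(1) *] \<open>n - 1 < t j\<close> by blast
qed

text \<open>Between \<open>v\<close> and the mark there are \<open>n - length v - 1\<close> free
  digits, and all else is forced. Hence targets of generation \<open>n\<close> are equidistributed
  among the cylinders of each level below \<open>n\<close>, whatever \<open>t\<close> is.\<close>

lemma card_target_extensions:
  assumes "length v < n"
  shows "real (card {D \<in> target t n. prefix v D}) = 2 ^ n / (2 * 2 ^ length v)"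
proof -
  obtain m where m: "n = length v + Suc m" using assms less_iff_Suc_add by auto
  let ?h = "\<lambda>u. v @ u @ [True] @ replicate (t n - n) False"
  have "{D \<in> target t n. prefix v D} = ?h ` {u. length u = m}"
  proof (intro set_eqI iffI)
    fix D assume "D \<in> {D \<in> target t n. prefix v D}"
    then obtain w where w: "D = w @ replicate (t n - n) False" "length w = n" "w \<noteq> []" "last w"
        "prefix v D"
      by (auto simp: target_def)
    have "prefix v w" using w m by (auto intro: prefix_length_prefix)
    then obtain u where u: "w = v @ u" by (auto simp: prefix_def)
    then obtain u' b where u': "u = u' @ [b]" using w(2) m by (cases u rule: rev_cases) auto
    then have "D = ?h u'" "length u' = m" using w(1-4) u m by simp_all
    then show "D \<in> ?h ` {u. length u = m}" by blast
  next
    fix D assume "D \<in> ?h ` {u. length u = m}"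
    then obtain u where u: "D = ?h u" "length u = m" by auto
    have "D \<in> target t n"
      unfolding target_def using u m
      by (intro CollectI exI[of _ "v @ u @ [True]"]) simp
    with u show "D \<in> {D \<in> target t n. prefix v D}" by simp
  qed
  moreover have "inj_on ?h {u. length u = m}" by (auto simp: inj_on_def)
  moreover have "card {u :: bool list. length u = m} = 2 ^ m"
    using card_lists_length_eq[of "UNIV :: bool set" m] by simp
  ultimately show ?thesis using m by (simp add: card_image power_add)
qed

section \<open>The null set of points hit finitely often\<close>

text \<open>Stated for ordered monoids so that it serves real masses and \<open>ennreal\<close>
  costs of covers alike.\<close>

lemma sum_Un_le:
  fixes f :: "'b \<Rightarrow> 'c :: ordered_comm_monoid_add"
  assumes "finite A" "finite B" "\<And>x. 0 \<le> f x"
  shows "sum f (A \<union> B) \<le> sum f A + sum f B"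
proof -
  have "sum f (A \<union> B) + 0 \<le> sum f (A \<union> B) + sum f (A \<inter> B)"
    using assms(3) by (intro add_left_mono sum_nonneg)
  also have "\<dots> = sum f A + sum f B" by (rule sum.union_inter[OF assms(1,2)])
  finally show ?thesis by simp
qed

lemma sum_UN_le:
  fixes f :: "'b \<Rightarrow> 'c :: ordered_comm_monoid_add"
  assumes "finite I" "\<And>i. i \<in> I \<Longrightarrow> finite (A i)" "\<And>x. 0 \<le> f x"
  shows "sum f (\<Union>i\<in>I. A i) \<le> (\<Sum>i\<in>I. sum f (A i))"
  using assms(1,2)
proof (induction I)
  case (insert i I)
  have "sum f (A i \<union> (\<Union>i\<in>I. A i)) \<le> sum f (A i) + sum f (\<Union>i\<in>I. A i)"
    using insert.hyps insert.prems assms(3) by (intro sum_Un_le) auto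
  also have "\<dots> \<le> sum f (A i) + (\<Sum>i\<in>I. sum f (A i))"
    using insert by (intro add_left_mono) auto
  finally show ?case using insert.hyps by simp
qed simp

lemma ex_large_partial_sum:
  fixes f :: "nat \<Rightarrow> real"
  assumes "\<And>n. 0 \<le> f n" "\<not> summable f"
  shows "\<exists>m\<ge>N. B < (\<Sum>n=N..<m. f n)"
proof (rule ccontr)
  assume "\<not> ?thesis"
  then have *: "(\<Sum>n=N..<m. f n) \<le> B" if "N \<le> m" for m using that by force
  have "summable f"
  proof (rule summableI_nonneg_bounded[OF assms(1)])
    fix m
    have "sum f {..<m} \<le> sum f {..<max N m}"
      using assms(1) by (intro sum_mono2) auto
    also have "{..<max N m} = {..<N} \<union> {N..<max N m}" by auto
    also have "sum f \<dots> = sum f {..<N} + sum f {N..<max N m}"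
      by (intro sum.union_disjoint) auto
    also have "\<dots> \<le> sum f {..<N} + B" using *[of "max N m"] by simp
    finally show "sum f {..<m} \<le> sum f {..<N} + B" .
  qed
  with assms(2) show False by simp
qed

lemma ex_small_tail:
  fixes f :: "nat \<Rightarrow> real"
  assumes "\<And>n. 0 \<le> f n" "summable f" "0 < e"
  shows "\<exists>M\<ge>N. \<forall>m. (\<Sum>n=M..<m. f n) \<le> e"
proof -
  obtain M where M: "\<And>m n. m \<ge> M \<Longrightarrow> norm (sum f {m..<n}) < e"
    using assms(2,3) unfolding summable_Cauchy by blast
  have "sum f {max M N..<m} \<le> e" for m
    using M[of "max M N" m] by simp
  then show ?thesis by (intro exI[of _ "max M N"]) auto
qed

text \<open>Discarding the targets that extend an earlier one, from generation \<open>N\<close> on,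
  leaves an antichain; the cylinders of the remaining targets are disjoint and their masses add
  up.\<close>

definition fresh :: "(nat \<Rightarrow> nat) \<Rightarrow> nat \<Rightarrow> bool list \<Rightarrow> nat \<Rightarrow> bool list set" where
  "fresh t N v n =
     {D \<in> target t n. prefix v D \<and> (\<forall>j\<in>{N..<n}. \<forall>D'\<in>target t j. \<not> prefix D' D)}"

lemma finite_fresh: "finite (fresh t N v n)"
  by (rule finite_subset[OF _ finite_target[of t n]]) (auto simp: fresh_def)

text \<open>The case \<open>n < n'\<close> contradicts the freshness of \<open>D'\<close>, the case
  \<open>n' < n\<close> contradicts the position of the mark.\<close>

lemma fresh_prefix_imp_eq:
  assumes t: "\<And>n. n \<le> t n"
    and "D \<in> fresh t N v n" "D' \<in> fresh t N v n'" "N \<le> n" "prefix D D'"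
  shows "n = n' \<and> D = D'"
proof -
  have D: "D \<in> target t n" "D' \<in> target t n'" using assms by (auto simp: fresh_def)
  have "\<not> n < n'" using assms D by (auto simp: fresh_def)
  moreover have "\<not> n' < n"
    using target_not_prefix_earlier[OF D(2,1)] t assms(5) by blast
  ultimately have "n = n'" by linarith
  moreover from this have "length D = length D'" using D t length_target by metis
  ultimately show ?thesis using assms(5) by (auto simp: prefix_def)
qed

text \<open>At least half of the targets below \<open>v\<close> are fresh. A spoiled one extends a
  target of an earlier generation \<open>j\<close> whose run has ended; there are
  \<open>2 ^ j / (2 * 2 ^ length v)\<close> of those below \<open>v\<close>, and by equidistribution
  each spoils at most \<open>2 ^ n / (2 * 2 ^ t j)\<close> targets.\<close>

lemma card_fresh:
  assumes t: "\<And>n. n \<le> t n" and v: "length v < N" "N \<le> n"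
    and s: "(\<Sum>j=N..<n. 2 ^ j / 2 ^ t j) \<le> (1/2::real)"
  shows "2 ^ n / (4 * 2 ^ length v) \<le> real (card (fresh t N v n))"
proof -
  let ?k = "length v"
  let ?T = "\<lambda>j. {D' \<in> target t j. prefix v D'}"
  \<comment> \<open>The condition \<open>t j < n\<close> loses no spoiled target and makes the
    equidistribution count applicable to \<open>D'\<close>.\<close>
  let ?C = "\<lambda>j D'. {D \<in> target t n. prefix D' D \<and> t j < n}"
  let ?B = "\<Union>j\<in>{N..<n}. \<Union>D'\<in>?T j. ?C j D'"
  have fin: "finite (?T j)" "finite (?C j D')" for j D'
    using finite_target by auto
  have sub: "?T n \<subseteq> fresh t N v n \<union> ?B"
  proof
    fix D assume D: "D \<in> ?T n"
    show "D \<in> fresh t N v n \<union> ?B"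
    proof (cases "D \<in> fresh t N v n")
      case False
      then obtain j D' where j: "j \<in> {N..<n}" "D' \<in> target t j" "prefix D' D"
        using D by (auto simp: fresh_def)
      then have "t j < n" using target_prefix_imp_less D t by auto
      moreover have "prefix v D'"
        using D j v t[of j] length_target[OF j(2) t]
        by (auto intro: prefix_length_prefix[of v D D'])
      ultimately show ?thesis using D j by blast
    qed simp
  qed
  have C: "real (card (?C j D')) \<le> 2 ^ n / (2 * 2 ^ t j)" if "D' \<in> ?T j" for j D'
  proof (cases "t j < n")
    case True
    have "length D' = t j" using that t length_target by auto
    then show ?thesis using card_target_extensions[of D' n t] True by simp
  qed simp
  have "real (card ?B) \<le> (\<Sum>j=N..<n. \<Sum>D'\<in>?T j. real (card (?C j D')))"
  proof -
    have "card ?B \<le> (\<Sum>j=N..<n. card (\<Union>D'\<in>?T j. ?C j D'))"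
      by (rule card_UN_le) simp
    also have "\<dots> \<le> (\<Sum>j=N..<n. \<Sum>D'\<in>?T j. card (?C j D'))"
      by (intro sum_mono card_UN_le fin)
    finally show ?thesis by (simp flip: of_nat_sum)
  qed
  also have "\<dots> \<le> (\<Sum>j=N..<n. \<Sum>D'\<in>?T j. 2 ^ n / (2 * 2 ^ t j))"
    by (intro sum_mono C)
  also have "\<dots> = (\<Sum>j=N..<n. 2 ^ j / (2 * 2 ^ ?k) * (2 ^ n / (2 * 2 ^ t j)))"
    using v by (intro sum.cong refl) (simp add: card_target_extensions)
  also have "\<dots> = 2 ^ n / (4 * 2 ^ ?k) * (\<Sum>j=N..<n. 2 ^ j / 2 ^ t j)"
    by (simp add: sum_distrib_left field_simps)
  also have "\<dots> \<le> 2 ^ n / (4 * 2 ^ ?k) * (1 / 2)"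
    using s by (intro mult_left_mono) auto
  finally have B: "real (card ?B) \<le> 2 ^ n / (4 * 2 ^ ?k) * (1 / 2)" .
  have "card (?T n) \<le> card (fresh t N v n) + card ?B"
    using sub finite_fresh fin by (meson card_Un_le card_mono finite_UN finite_Un finite_atLeastLessThan le_trans)
  then have le: "real (card (?T n)) \<le> real (card (fresh t N v n)) + real (card ?B)"
    by linarith
  have eq: "real (card (?T n)) = 2 * (2 ^ n / (4 * 2 ^ ?k))"
    using v by (subst card_target_extensions) auto
  \<comment> \<open>With \<open>q\<close> for \<open>2 ^ n / (4 * 2 ^ length v)\<close>: there are
    \<open>2 * q\<close> targets in all and at most \<open>q / 2\<close> are spoiled.\<close>
  have "q \<le> f" if "a \<le> f + b" "a = 2 * q" "b \<le> q * (1/2)" "0 \<le> q" for a b f q :: real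
    using that by linarith
  from this[OF le eq B] show ?thesis by simp
qed

text \<open>The weight \<open>g\<close> is kept general: it is \<open>(1/2) ^ n\<close> when masses
  are measured and the cost \<open>f ((1/3) ^ n)\<close> when covers are. The bound on partial sums
  is required only below \<open>m\<close>, so \<open>m\<close> may be the first index at which it
  fails.\<close>

lemma sum_fresh_ge:
  fixes g :: "nat \<Rightarrow> real"
  assumes t: "\<And>n. n \<le> t n" and g: "\<And>n. 0 \<le> g n" and v: "length v < N"
    and s: "\<And>n. n < m \<Longrightarrow> (\<Sum>j=N..<n. 2 ^ j / 2 ^ t j) \<le> (1/2::real)"
  shows "(\<Sum>n=N..<m. 2 ^ n * g (t n)) / (4 * 2 ^ length v) \<le>
           (\<Sum>D\<in>(\<Union>n\<in>{N..<m}. fresh t N v n). g (length D))"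
proof -
  have "(\<Sum>D\<in>(\<Union>n\<in>{N..<m}. fresh t N v n). g (length D)) =
      (\<Sum>n=N..<m. \<Sum>D\<in>fresh t N v n. g (length D))"
    using fresh_prefix_imp_eq[OF t] finite_fresh
    by (intro sum.UNION_disjoint) fastforce+
  also have "\<dots> = (\<Sum>n=N..<m. real (card (fresh t N v n)) * g (t n))"
  proof (rule sum.cong[OF refl])
    fix n
    have "(\<Sum>D\<in>fresh t N v n. g (length D)) = (\<Sum>D\<in>fresh t N v n. g (t n))"
      using length_target t by (intro sum.cong) (auto simp: fresh_def)
    then show "(\<Sum>D\<in>fresh t N v n. g (length D)) = real (card (fresh t N v n)) * g (t n)" by simp
  qed
  also have "\<dots> \<ge> (\<Sum>n=N..<m. 2 ^ n / (4 * 2 ^ length v) * g (t n))"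
    using g v s by (intro sum_mono mult_right_mono card_fresh t) auto
  finally show ?thesis by (simp add: sum_divide_distrib)
qed

text \<open>With at most mass 1/2 of earlier targets, the fresh ones fill at least 1/8 of \<open>v\<close>; each step
  therefore leaves at most 7/8 of the mass of \<open>v\<close> uncovered.\<close>

lemma null_cover:
  assumes t: "\<And>n. n \<le> t n" and ns: "\<not> summable (\<lambda>n. 2 ^ n / 2 ^ t n :: real)"
  shows "\<exists>R. finite R \<and> (\<Sum>w\<in>R. (1/2::real) ^ length w) \<le> (7/8) ^ i * (1/2) ^ length v \<and>
     (\<forall>x \<in> cantor_set \<inter> cyl v. (\<exists>w\<in>R. x \<in> cyl w) \<or> (\<exists>n\<ge>N. \<exists>D\<in>target t n. x \<in> cyl D))"
proof (induction i arbitrary: v)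
  case 0
  show ?case by (rule exI[of _ "{v}"]) auto
next
  case (Suc i)
  let ?k = "length v"
  let ?w = "\<lambda>w::bool list. (1/2::real) ^ length w"
  let ?S = "\<lambda>M m. \<Sum>j=M..<m. 2 ^ j / 2 ^ t j :: real"
  define M where "M = max N (Suc ?k)"
  \<comment> \<open>The first index at which the mass exceeds 1/2: the fresh count is valid for all
    generations below \<open>m\<close>, and together they carry more than
    \<open>1/2 / 4 = 1/8\<close> of the mass of \<open>v\<close>.\<close>
  define m where "m = (LEAST m. ?S M m > 1/2)"
  have "\<exists>m. ?S M m > 1/2" using ex_large_partial_sum[OF _ ns, of M "1/2"] by auto
  then have m: "?S M m > 1/2" "\<And>n. n < m \<Longrightarrow> ?S M n \<le> 1/2"
    unfolding m_def by (auto intro: LeastI_ex dest: not_less_Least)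
  define G where "G = (\<Union>n\<in>{M..<m}. fresh t M v n)"
  have finG: "finite G" using finite_fresh by (auto simp: G_def)
  have inc: "D = D'" if "D \<in> G" "D' \<in> G" "prefix D D'" for D D'
    using fresh_prefix_imp_eq[OF t] that by (fastforce simp: G_def)
  have vG: "prefix v D" if "D \<in> G" for D using that by (auto simp: G_def fresh_def)
  have "1 / 8 * ?w v \<le> ?S M m / (4 * 2 ^ ?k)"
    using m(1) by (simp add: power_one_over field_simps)
  also have "\<dots> = (\<Sum>n=M..<m. 2 ^ n * (1/2) ^ t n) / (4 * 2 ^ ?k)"
    by (simp add: power_one_over divide_simps)
  also have "\<dots> \<le> (\<Sum>D\<in>G. ?w D)"
    unfolding G_def using m(2) by (intro sum_fresh_ge t) (auto simp: M_def)
  finally have wG: "1 / 8 * ?w v \<le> (\<Sum>D\<in>G. ?w D)" .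
  \<comment> \<open>Refining everything to one common length \<open>T\<close> turns the part of
    \<open>v\<close> missed by \<open>G\<close> into a set \<open>U\<close> of words of equal
    length, to each of which the induction hypothesis applies.\<close>
  define T where "T = Max (insert ?k (length ` G))"
  have T: "?k \<le> T" "\<And>D. D \<in> G \<Longrightarrow> length D \<le> T" using finG by (auto simp: T_def)
  let ?E = "\<lambda>D :: bool list. {u. length u = T \<and> prefix D u}"
  define U where "U = {u \<in> ?E v. \<forall>D\<in>G. \<not> prefix D u}"
  have finE: "finite (?E D)" for D
    by (rule finite_subset[OF _ finite_words[of T]]) auto
  have finU: "finite U" unfolding U_def by (rule finite_subset[OF _ finE[of v]]) auto
  have cardE: "real (card (?E D)) = 2 ^ T * ?w D" if "length D \<le> T" for D
  proof -
    have "(2::real) ^ T = 2 ^ length D * 2 ^ (T - length D)"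
      using that by (simp flip: power_add)
    then show ?thesis
      using card_extensions[of D "T - length D"] that by (simp add: power_one_over)
  qed
  have disj: "?E D \<inter> ?E D' = {}" if "D \<in> G" "D' \<in> G" "D \<noteq> D'" for D D'
    using inc that prefix_same_cases by blast
  have "card (\<Union>D\<in>G. ?E D) = (\<Sum>D\<in>G. card (?E D))"
    by (rule card_UN_disjoint) (use finG finE disj in blast)+
  then have "card U + (\<Sum>D\<in>G. card (?E D)) = card U + card (\<Union>D\<in>G. ?E D)"
    by simp
  also have "\<dots> = card (U \<union> (\<Union>D\<in>G. ?E D))"
    using finU finG finE by (intro card_Un_disjoint[symmetric] finite_UN_I) (auto simp: U_def)
  also have "\<dots> \<le> card (?E v)"
    using vG prefix_order.trans by (intro card_mono finE) (auto simp: U_def)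
  finally have "real (card U) + (\<Sum>D\<in>G. real (card (?E D))) \<le> real (card (?E v))"
    by (simp flip: of_nat_sum of_nat_add)
  then have "real (card U) + 2 ^ T * (\<Sum>D\<in>G. ?w D) \<le> 2 ^ T * ?w v"
    using T by (simp add: cardE sum_distrib_left)
  moreover have "2 ^ T * (1 / 8 * ?w v) \<le> 2 ^ T * (\<Sum>D\<in>G. ?w D)"
    using wG by (intro mult_left_mono) auto
  moreover have "c \<le> 7/8 * y * p" if "c + p * s \<le> p * y" "p * (1/8 * y) \<le> p * s"
    for c p s y :: real using that by (simp add: algebra_simps)
  ultimately have cardU: "real (card U) \<le> 7/8 * ?w v * 2 ^ T" by blast
  obtain R where R: "\<And>u. finite (R u)" "\<And>u. (\<Sum>w\<in>R u. ?w w) \<le> (7/8) ^ i * ?w u"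
     "\<And>u x. x \<in> cantor_set \<Longrightarrow> x \<in> cyl u \<Longrightarrow>
        (\<exists>w\<in>R u. x \<in> cyl w) \<or> (\<exists>n\<ge>N. \<exists>D\<in>target t n. x \<in> cyl D)"
    using Suc by (metis IntI)
  show ?case
  proof (intro exI[of _ "\<Union>u\<in>U. R u"] conjI ballI)
    show "finite (\<Union>u\<in>U. R u)" using finU R by auto
    have "(\<Sum>w\<in>(\<Union>u\<in>U. R u). ?w w) \<le> (\<Sum>u\<in>U. \<Sum>w\<in>R u. ?w w)"
      by (intro sum_UN_le finU R) auto
    also have "\<dots> \<le> (\<Sum>u\<in>U. (7/8) ^ i * ?w u)"
      by (intro sum_mono R)
    also have "\<dots> = real (card U) * ((7/8) ^ i * (1/2) ^ T)"
      by (simp add: U_def)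
    also have "\<dots> \<le> (7/8 * ?w v * 2 ^ T) * ((7/8) ^ i * (1/2) ^ T)"
      by (intro mult_right_mono cardU) auto
    also have "\<dots> = (7/8) ^ Suc i * ?w v" by (simp add: power_one_over)
    finally show "(\<Sum>w\<in>(\<Union>u\<in>U. R u). ?w w) \<le> (7/8) ^ Suc i * ?w v" .
  next
    fix x assume x: "x \<in> cantor_set \<inter> cyl v"
    then obtain u where u: "length u = T" "x \<in> cyl u" by (auto simp: cantor_set_iff)
    then have "prefix v u" using x T by (intro cyl_imp_prefix) auto
    show "(\<exists>w\<in>(\<Union>u\<in>U. R u). x \<in> cyl w) \<or> (\<exists>n\<ge>N. \<exists>D\<in>target t n. x \<in> cyl D)"
    proof (cases "u \<in> U")
      case True
      then show ?thesis using R(3)[of x u] x u by blast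
    next
      case False
      then obtain D where D: "D \<in> G" "prefix D u" using u \<open>prefix v u\<close> by (auto simp: U_def)
      then have "x \<in> cyl D" using u cyl_prefix_subset by blast
      moreover have "\<exists>n\<ge>N. D \<in> target t n" using D by (auto simp: G_def M_def fresh_def)
      ultimately show ?thesis by blast
    qed
  qed
qed

text \<open>The bounds are summable over \<open>N\<close>, so all families \<open>R N\<close>
  together have mass at most \<open>e\<close> times that of \<open>v\<close>. A point of the Cantor
  set in \<open>v\<close> that avoids all of them is hit in arbitrarily late generations.\<close>

lemma null_cover_Union:
  assumes t: "\<And>n. n \<le> t n" and ns: "\<not> summable (\<lambda>n. 2 ^ n / 2 ^ t n :: real)" and e: "0 < e"
  shows "\<exists>R. \<forall>N::nat. finite (R N) \<and>
    (\<Sum>w\<in>R N. (1/2::real) ^ length w) \<le> e * (1/2) ^ length v * (1/2) ^ Suc N \<and>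
    (\<forall>x \<in> cantor_set \<inter> cyl v.
       (\<exists>w\<in>R N. x \<in> cyl w) \<or> (\<exists>n\<ge>N. \<exists>D\<in>target t n. x \<in> cyl D))"
proof (intro choice allI)
  fix N
  have "(7/8::real) < 1" "0 < e * (1/2) ^ Suc N" using e by simp_all
  then obtain i where "(7/8::real) ^ i < e * (1/2) ^ Suc N"
    using real_arch_pow_inv by blast
  then have "(7/8::real) ^ i * (1/2) ^ length v \<le> e * (1/2) ^ Suc N * (1/2) ^ length v"
    by (intro mult_right_mono) auto
  also have "\<dots> = e * (1/2) ^ length v * (1/2) ^ Suc N" by (simp only: mult_ac)
  finally show "\<exists>R. finite R \<and>
    (\<Sum>w\<in>R. (1/2::real) ^ length w) \<le> e * (1/2) ^ length v * (1/2) ^ Suc N \<and>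
    (\<forall>x \<in> cantor_set \<inter> cyl v.
       (\<exists>w\<in>R. x \<in> cyl w) \<or> (\<exists>n\<ge>N. \<exists>D\<in>target t n. x \<in> cyl D))"
    using null_cover[OF t ns, of i v N] by (meson order_trans)
qed

section \<open>Points avoiding a cheap family of cylinders\<close>

text \<open>Dependent choice builds strictly lengthening words whose cylinders shrink to a point.
  The requirement \<open>Q n\<close> at step \<open>n\<close> allows the caller to ask for later and
  later generations.\<close>

lemma chain_point:
  assumes "P v"
    and step: "\<And>v n. P v \<Longrightarrow> \<exists>D. prefix v D \<and> length v < length D \<and> P D \<and> Q n D"
  obtains x where "x \<in> cantor_set" "x \<in> cyl v"
    "\<And>n::nat. \<exists>D. P D \<and> Q n D \<and> n < length D \<and> x \<in> cyl D"
proof -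
  have "\<exists>f. \<forall>n. (P (f n) \<and> (n = 0 \<longrightarrow> f n = v)) \<and>
      (prefix (f n) (f (Suc n)) \<and> length (f n) < length (f (Suc n)) \<and> Q n (f (Suc n)))"
    using assms by (intro dependent_nat_choice) auto
  then obtain f where f: "\<And>n. P (f n)" "f 0 = v" "\<And>n. prefix (f n) (f (Suc n))"
    "\<And>n. length (f n) < length (f (Suc n))" "\<And>n. Q n (f (Suc n))" by blast
  have len: "n \<le> length (f n)" for n
  proof (induction n)
    case (Suc n)
    then show ?case using f(4)[of n] by linarith
  qed simp
  obtain x where x: "x \<in> cantor_set" "\<And>i. x \<in> cyl (f i)"
    using cantor_set_prefix_chain[of f] f(3) len by blast
  show ?thesis
  proof (rule that[OF x(1)])
    show "x \<in> cyl v" using x(2)[of 0] f(2) by simp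
    show "\<exists>D. P D \<and> Q n D \<and> n < length D \<and> x \<in> cyl D" for n
      using f(1,5) x(2) len[of "Suc n"] by (intro exI[of _ "f (Suc n)"]) auto
  qed
qed

text \<open>This makes precise that the family \<open>Q\<close> is cheap relative to
  \<open>v\<close>. Bounding finite subfamilies avoids infinite sums, whose convergence is not known
  beforehand.\<close>

definition light :: "(nat \<Rightarrow> real) \<Rightarrow> bool list set \<Rightarrow> real \<Rightarrow> bool list \<Rightarrow> bool" where
  "light g Q c v \<longleftrightarrow>
     (\<forall>F \<subseteq> {A \<in> Q. prefix v A}. finite F \<longrightarrow> (\<Sum>A\<in>F. g (length A)) \<le> c * g (length v))"

text \<open>A Markov type inequality: each \<open>D\<close> in \<open>B\<close> has an expensive
  finite part of \<open>Q\<close> below it, these parts are disjoint because \<open>B\<close> is an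
  antichain, and together they lie below \<open>v\<close>, where \<open>Q\<close> is cheap.\<close>

lemma sum_not_light_less:
  assumes "finite B" "B \<noteq> {}" "light g Q c v"
    and v: "\<And>D. D \<in> B \<Longrightarrow> prefix v D"
    and inc: "\<And>D D'. D \<in> B \<Longrightarrow> D' \<in> B \<Longrightarrow> prefix D D' \<Longrightarrow> D = D'"
    and B: "\<And>D. D \<in> B \<Longrightarrow> \<not> light g Q c' D"
  shows "(\<Sum>D\<in>B. c' * g (length D)) < c * g (length v)"
proof -
  have "\<forall>D\<in>B. \<exists>F. F \<subseteq> {A \<in> Q. prefix D A} \<and> finite F \<and> c' * g (length D) < (\<Sum>A\<in>F. g (length A))"
    using B by (force simp: light_def not_le)
  then obtain F where F: "\<And>D. D \<in> B \<Longrightarrow> F D \<subseteq> {A \<in> Q. prefix D A}" "\<And>D. D \<in> B \<Longrightarrow> finite (F D)"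
      "\<And>D. D \<in> B \<Longrightarrow> c' * g (length D) < (\<Sum>A\<in>F D. g (length A))"
    by metis
  have "(\<Sum>D\<in>B. c' * g (length D)) < (\<Sum>D\<in>B. \<Sum>A\<in>F D. g (length A))"
    using assms(1,2) F(3) by (intro sum_strict_mono)
  also have "\<dots> = (\<Sum>A\<in>(\<Union>D\<in>B. F D). g (length A))"
  proof (rule sum.UNION_disjoint[symmetric])
    show "\<forall>D\<in>B. \<forall>D'\<in>B. D \<noteq> D' \<longrightarrow> F D \<inter> F D' = {}"
      using F(1) inc prefix_same_cases by blast
  qed (use assms(1) F(2) in auto)
  also have "\<dots> \<le> c * g (length v)"
  proof -
    have "(\<Union>D\<in>B. F D) \<subseteq> {A \<in> Q. prefix v A}"
      using F(1) v prefix_order.trans by blast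
    moreover have "finite (\<Union>D\<in>B. F D)" using assms(1) F(2) by blast
    ultimately show ?thesis using assms(3) by (auto simp: light_def)
  qed
  finally show ?thesis .
qed

lemma not_in_cyl_of_chain:
  assumes "\<And>n::nat. \<exists>D. (\<forall>A\<in>Q. \<not> prefix A D) \<and> n < length D \<and> x \<in> cyl D" "A \<in> Q"
  shows "x \<notin> cyl A"
proof
  assume "x \<in> cyl A"
  obtain D where "\<not> prefix A D" "length A < length D" "x \<in> cyl D"
    using assms by blast
  with \<open>x \<in> cyl A\<close> show False using cyl_imp_prefix[of x A D] by simp
qed

text \<open>The two children of a word carry together its mass, so a light word has a light child. A
  light word is not in \<open>Q\<close>, as its own mass would exceed the permitted fraction
  \<open>\<theta> < 1\<close>. Descending through light children leads to a point outside all
  cylinders of \<open>Q\<close>.\<close>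

lemma light_miss:
  assumes "light (\<lambda>n. (1/2) ^ n) Q \<theta> v" "\<theta> < 1" "\<forall>A\<in>Q. \<not> strict_prefix A v"
  obtains x where "x \<in> cantor_set" "x \<in> cyl v" "\<And>A. A \<in> Q \<Longrightarrow> x \<notin> cyl A"
proof -
  let ?g = "\<lambda>n::nat. (1/2::real) ^ n"
  have notin: "v \<notin> Q" if "light ?g Q \<theta> v" for v
  proof
    assume "v \<in> Q"
    then have "?g (length v) \<le> \<theta> * ?g (length v)"
      using that[unfolded light_def, rule_format, of "{v}"] by simp
    then show False using assms(2) by simp
  qed
  define P where "P = (\<lambda>v. light ?g Q \<theta> v \<and> (\<forall>A\<in>Q. \<not> prefix A v))"
  have "P v"
    using assms(1,3) notin by (auto simp: P_def strict_prefix_def)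
  moreover have "\<exists>D. prefix v D \<and> length v < length D \<and> P D \<and> True" if "P v" for v
  proof -
    have "\<exists>b. light ?g Q \<theta> (v @ [b])"
    proof (rule ccontr)
      assume "\<not> ?thesis"
      then have "(\<Sum>D\<in>{v @ [True], v @ [False]}. \<theta> * ?g (length D)) < \<theta> * ?g (length v)"
        using that by (intro sum_not_light_less[where Q = Q]) (auto simp: P_def)
      then show False by simp
    qed
    then obtain b where b: "light ?g Q \<theta> (v @ [b])" ..
    moreover have "\<forall>A\<in>Q. \<not> prefix A (v @ [b])"
      using notin[OF b] that by (auto simp: P_def)
    ultimately show ?thesis by (intro exI[of _ "v @ [b]"]) (auto simp: P_def)
  qed
  ultimately obtain x where x: "x \<in> cantor_set" "x \<in> cyl v"
      "\<And>n::nat. \<exists>D. P D \<and> True \<and> n < length D \<and> x \<in> cyl D"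
    using chain_point[of P v "\<lambda>_ _. True"] by blast
  show ?thesis
  proof (rule that[OF x(1,2)])
    show "x \<notin> cyl A" if "A \<in> Q" for A
      using x(3) that by (intro not_in_cyl_of_chain[of Q]) (auto simp: P_def)
  qed
qed

text \<open>Fresh targets below \<open>v\<close> cost at least \<open>S / (4 * 2 ^ length v)\<close>
  in total. If none of them can continue the chain, each is swallowed by a member of
  \<open>Q\<close> or is not light; both sorts together cost too little once \<open>S\<close> is
  large against \<open>u\<close>.\<close>

lemma light_step:
  fixes g :: "nat \<Rightarrow> real"
  assumes t: "\<And>n. n \<le> t n"
    and pos: "\<And>n. 0 < g n" and dec: "\<And>m n. m \<le> n \<Longrightarrow> g n \<le> g m"
    and inc: "\<And>m n. m \<le> n \<Longrightarrow> 2 ^ m * g m \<le> 2 ^ n * g n"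
    and sm: "summable (\<lambda>n. 2 ^ n / 2 ^ t n :: real)"
    and ns: "\<not> summable (\<lambda>n. 2 ^ n * g (t n))"
    and lt: "light g Q (1/16) v" and Q: "\<forall>A\<in>Q. \<not> prefix A v"
  shows "\<exists>D. prefix v D \<and> length v < length D \<and> (light g Q (1/16) D \<and> (\<forall>A\<in>Q. \<not> prefix A D)) \<and>
           (\<exists>n\<ge>N. D \<in> target t n)"
proof (rule ccontr)
  assume none: "\<not> ?thesis"
  let ?k = "length v"
  \<comment> \<open>The cost of all words of length \<open>?k\<close> together; it is the scale
    against which \<open>S\<close> is measured.\<close>
  define u where "u = 2 ^ ?k * g ?k"
  have "0 < u" using pos by (simp add: u_def)
  \<comment> \<open>The tail bound beyond \<open>M\<close> keeps the count of fresh targets valid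
    for every \<open>m\<close>, so divergence of the cost series allows \<open>m\<close> to be taken
    as far as the bound \<open>16 * u\<close> demands.\<close>
  obtain M where M: "max N (Suc ?k) \<le> M" "\<And>m. (\<Sum>n=M..<m. 2 ^ n / 2 ^ t n) \<le> (1/2::real)"
    using ex_small_tail[OF _ sm, of "1/2" "max N (Suc ?k)"] by auto
  obtain m where m: "16 * u < (\<Sum>n=M..<m. 2 ^ n * g (t n))"
    using ex_large_partial_sum[OF _ ns, of M "16 * u"] pos by (auto simp: less_imp_le)
  define S where "S = (\<Sum>n=M..<m. 2 ^ n * g (t n))"
  define G where "G = (\<Union>n\<in>{M..<m}. fresh t M v n)"
  have finG: "finite G" using finite_fresh by (auto simp: G_def)
  have incG: "D = D'" if "D \<in> G" "D' \<in> G" "prefix D D'" for D D'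
    using fresh_prefix_imp_eq[OF t] that by (fastforce simp: G_def)
  have vG: "prefix v D" if "D \<in> G" for D using that by (auto simp: G_def fresh_def)
  have tG: "\<exists>n. M \<le> n \<and> n < m \<and> D \<in> target t n" if "D \<in> G" for D
    using that by (auto simp: G_def fresh_def)
  have lG: "?k < length D" if D: "D \<in> G" for D
  proof -
    obtain n where n: "M \<le> n" "D \<in> target t n" using tG[OF D] by blast
    then have "length D = t n" using length_target t by blast
    then show ?thesis using n(1) M(1) t[of n] by simp
  qed
  have big: "S / (4 * 2 ^ ?k) \<le> (\<Sum>D\<in>G. g (length D))"
    unfolding S_def G_def using M pos by (intro sum_fresh_ge t) (auto simp: less_imp_le)
  \<comment> \<open>\<open>K\<close> collects the targets swallowed by \<open>Q\<close>,
    \<open>L\<close> those in which \<open>Q\<close> is expensive; by \<open>none\<close> they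
    exhaust \<open>G\<close>.\<close>
  define K where "K = {D \<in> G. \<exists>A\<in>Q. prefix A D}"
  define L where "L = {D \<in> G. \<not> light g Q (1/16) D}"
  have KL: "G \<subseteq> K \<union> L"
  proof
    fix D assume D: "D \<in> G"
    moreover have "\<exists>n\<ge>N. D \<in> target t n" using tG[OF D] M(1) by (meson max.bounded_iff order_trans)
    ultimately show "D \<in> K \<union> L" using none vG lG by (auto simp: K_def L_def)
  qed
  have sumL: "(\<Sum>D\<in>L. g (length D)) \<le> g ?k"
  proof (cases "L = {}")
    case False
    have "(\<Sum>D\<in>L. 1/16 * g (length D)) < 1/16 * g ?k"
      using False finG lt vG incG by (intro sum_not_light_less[where Q = Q]) (auto simp: L_def)
    then show ?thesis by (simp flip: sum_divide_distrib)
  qed (use pos in \<open>simp add: less_imp_le\<close>)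
  text \<open>At most one target of generation at most \<open>length A\<close> extends \<open>A\<close>, since the mark would fall
    into the zeros of an earlier one. Later targets extending \<open>A\<close> are equidistributed in \<open>A\<close>.\<close>
  have kill: "(\<Sum>D\<in>{D \<in> G. prefix A D}. g (length D)) \<le> (1 + S / u) * g (length A)" if "?k \<le> length A" for A
  proof -
    let ?a = "length A"
    define G1 where "G1 = {D \<in> G. prefix A D \<and> (\<exists>n\<le>?a. D \<in> target t n)}"
    define G2 where "G2 = (\<Union>n\<in>{n \<in> {M..<m}. ?a < n}. {D \<in> target t n. prefix A D})"
    have fin: "finite G1" "finite G2" using finG finite_target by (auto simp: G1_def G2_def)
    have sub: "{D \<in> G. prefix A D} \<subseteq> G1 \<union> G2"
    proof
      fix D assume D: "D \<in> {D \<in> G. prefix A D}"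
      then obtain n where "M \<le> n" "n < m" "D \<in> target t n" using tG by blast
      then show "D \<in> G1 \<union> G2" using D by (cases "n \<le> ?a") (auto simp: G1_def G2_def)
    qed
    have G1: "D = D'" if D: "D \<in> G1" "D' \<in> G1" for D D'
    proof -
      obtain n n' where n: "D \<in> target t n" "D' \<in> target t n'" "n \<le> ?a" "n' \<le> ?a"
          "prefix A D" "prefix A D'"
        using D by (auto simp: G1_def)
      have nest: False if "i < j" "E \<in> target t i" "E' \<in> target t j" "j \<le> ?a" "prefix A E" "prefix A E'"
        for i j E E'
      proof -
        have j: "0 < j" "E' ! (j - 1)" using nth_target_True that by blast+
        then have "j - 1 < ?a" using that by linarith
        then have "E ! (j - 1) = E' ! (j - 1)"
          using prefix_nth[OF that(5)] prefix_nth[OF that(6)] by simp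
        moreover have "?a \<le> t i"
          using prefix_length_le[OF that(5)] length_target[OF that(2) t] by simp
        ultimately show False
          using nth_target_False[OF that(2), of "j - 1"] j that(1) \<open>j - 1 < ?a\<close> by simp
      qed
      have "\<not> n < n'" using nest[OF _ n(1,2,4,5,6)] by blast
      moreover have "\<not> n' < n" using nest[OF _ n(2,1,3,6,5)] by blast
      ultimately have "n = n'" by simp
      then show ?thesis using target_eqI[of D t n D' A] n by simp
    qed
    have "(\<Sum>D\<in>{D \<in> G. prefix A D}. g (length D)) \<le> (\<Sum>D\<in>G1 \<union> G2. g (length D))"
      using fin sub pos by (intro sum_mono2) (auto simp: less_imp_le)
    also have "\<dots> \<le> (\<Sum>D\<in>G1. g (length D)) + (\<Sum>D\<in>G2. g (length D))"
      using fin pos by (intro sum_Un_le) (auto simp: less_imp_le)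
    also have "(\<Sum>D\<in>G1. g (length D)) \<le> g ?a"
    proof (cases "G1 = {}")
      case False
      then obtain D where D: "G1 = {D}" using G1 by blast
      then have "prefix A D" by (auto simp: G1_def)
      then show ?thesis using D dec prefix_length_le by auto
    qed (use pos in \<open>simp add: less_imp_le\<close>)
    also have "(\<Sum>D\<in>G2. g (length D)) \<le> S / 2 ^ ?a"
    proof -
      have "(\<Sum>D\<in>G2. g (length D)) \<le>
          (\<Sum>n\<in>{n \<in> {M..<m}. ?a < n}. \<Sum>D\<in>{D \<in> target t n. prefix A D}. g (length D))"
        unfolding G2_def using finite_target pos by (intro sum_UN_le) (auto simp: less_imp_le)
      also have "\<dots> = (\<Sum>n\<in>{n \<in> {M..<m}. ?a < n}. 2 ^ n / (2 * 2 ^ ?a) * g (t n))"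
      proof (rule sum.cong[OF refl])
        fix n assume n: "n \<in> {n \<in> {M..<m}. ?a < n}"
        have "(\<Sum>D\<in>{D \<in> target t n. prefix A D}. g (length D)) =
            (\<Sum>D\<in>{D \<in> target t n. prefix A D}. g (t n))"
          using length_target t by (intro sum.cong) auto
        then show "(\<Sum>D\<in>{D \<in> target t n. prefix A D}. g (length D)) = 2 ^ n / (2 * 2 ^ ?a) * g (t n)"
          using n by (simp add: card_target_extensions)
      qed
      also have "\<dots> \<le> (\<Sum>n=M..<m. 2 ^ n / (2 * 2 ^ ?a) * g (t n))"
        using pos by (intro sum_mono2) (auto simp: less_imp_le)
      also have "\<dots> = S / 2 ^ ?a / 2"
        by (simp add: S_def sum_divide_distrib mult_ac)
      also have "\<dots> \<le> S / 2 ^ ?a"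
      proof -
        have nonneg: "0 \<le> S / 2 ^ ?a" using m \<open>0 < u\<close> by (simp add: S_def)
        have half: "x / 2 \<le> x" if "0 \<le> x" for x :: real using that by simp
        show ?thesis by (rule half[OF nonneg])
      qed
      finally show ?thesis .
    qed
    \<comment> \<open>Here the growth of \<open>2 ^ n * g n\<close> enters:
      \<open>u \<le> 2 ^ ?a * g ?a\<close> since \<open>A\<close> is at least as long as
      \<open>v\<close>.\<close>
    also have "S / 2 ^ ?a \<le> S / u * g ?a"
    proof -
      have "u \<le> 2 ^ ?a * g ?a" using inc that by (simp add: u_def)
      then have "S * u \<le> S * (2 ^ ?a * g ?a)"
        using m \<open>0 < u\<close> by (intro mult_left_mono) (auto simp: S_def)
      then show ?thesis using \<open>0 < u\<close> by (simp add: field_simps)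
    qed
    finally show ?thesis by (simp add: algebra_simps)
  qed
  have sumK: "(\<Sum>D\<in>K. g (length D)) \<le> (1 + S / u) * (1/16 * g ?k)"
  proof -
    have "\<forall>D\<in>K. \<exists>A. A \<in> Q \<and> prefix A D" by (auto simp: K_def)
    from bchoice[OF this] obtain a where a: "\<And>D. D \<in> K \<Longrightarrow> a D \<in> Q \<and> prefix (a D) D"
      by blast
    \<comment> \<open>Both \<open>v\<close> and \<open>a D\<close> are prefixes of \<open>D\<close>,
      hence comparable, and no member of \<open>Q\<close> is a prefix of \<open>v\<close>.\<close>
    have va: "prefix v (a D)" if "D \<in> K" for D
      using a[OF that] Q vG[of D] that prefix_same_cases[of v D "a D"] by (auto simp: K_def)
    have finK: "finite K" using finG by (auto simp: K_def)
    have "(\<Sum>D\<in>K. g (length D)) \<le> (\<Sum>D\<in>(\<Union>A\<in>a ` K. {D \<in> G. prefix A D}). g (length D))"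
      using a finK finG pos by (intro sum_mono2) (auto simp: K_def less_imp_le)
    also have "\<dots> \<le> (\<Sum>A\<in>a ` K. \<Sum>D\<in>{D \<in> G. prefix A D}. g (length D))"
      using finK finG pos by (intro sum_UN_le) (auto simp: less_imp_le)
    also have "\<dots> \<le> (\<Sum>A\<in>a ` K. (1 + S / u) * g (length A))"
      using va prefix_length_le by (intro sum_mono kill) blast
    also have "\<dots> = (1 + S / u) * (\<Sum>A\<in>a ` K. g (length A))"
      by (simp add: sum_distrib_left)
    also have "\<dots> \<le> (1 + S / u) * (1/16 * g ?k)"
    proof (rule mult_left_mono)
      show "(\<Sum>A\<in>a ` K. g (length A)) \<le> 1/16 * g ?k"
        using lt[unfolded light_def, rule_format, of "a ` K"] a va finK by blast
      show "0 \<le> 1 + S / u" using m \<open>0 < u\<close> by (simp add: S_def)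
    qed
    finally show ?thesis .
  qed
  have "(\<Sum>D\<in>G. g (length D)) \<le> (\<Sum>D\<in>K \<union> L. g (length D))"
    using KL finG pos by (intro sum_mono2) (auto simp: K_def L_def less_imp_le)
  also have "\<dots> \<le> (\<Sum>D\<in>K. g (length D)) + (\<Sum>D\<in>L. g (length D))"
    using finG pos by (intro sum_Un_le) (auto simp: K_def L_def less_imp_le)
  finally have "S / (4 * 2 ^ ?k) \<le> (1 + S / u) * (1/16 * g ?k) + g ?k"
    using big sumK sumL by linarith
  then have "2 ^ ?k * (S / (4 * 2 ^ ?k)) \<le> 2 ^ ?k * ((1 + S / u) * (1/16 * g ?k) + g ?k)"
    by (intro mult_left_mono) auto
  also have "\<dots> = (1 + S / u) * (1/16 * u) + u"
  proof -
    have "p * ((1 + z) * (1/16 * y) + y) = (1 + z) * (1/16 * (p * y)) + p * y" for p y z :: real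
      by (simp add: algebra_simps)
    then show ?thesis unfolding u_def .
  qed
  also have "\<dots> = 17/16 * u + S / 16"
    using \<open>0 < u\<close> by (simp add: algebra_simps add_divide_distrib)
  \<comment> \<open>The inequality reads \<open>S / 4 \<le> 17/16 * u + S / 16\<close>, that is
    \<open>3 * S \<le> 17 * u\<close>, against \<open>16 * u < S\<close>.\<close>
  finally show False using m \<open>0 < u\<close> by (simp add: S_def)
qed

text \<open>Each element of \<open>F\<close> is assigned to one family containing it, and the
  weights \<open>(1/2) ^ Suc N\<close> sum to 1.\<close>

lemma sum_le_geometric:
  fixes f :: "'b \<Rightarrow> real"
  assumes R: "\<And>N. finite (R N)" "\<And>N. sum f (R N) \<le> c * (1/2) ^ Suc N" and f: "\<And>x. 0 \<le> f x"
    and F: "finite F" "F \<subseteq> (\<Union>N. R N)"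
  shows "sum f F \<le> c"
proof -
  obtain h where h: "\<And>x. x \<in> F \<Longrightarrow> x \<in> R (h x)" using F(2) by (metis UN_iff subsetD)
  have "0 \<le> sum f (R 0)" using f by (simp add: sum_nonneg)
  then have "0 \<le> c" using R(2)[of 0] by simp
  have "sum f F \<le> sum f (\<Union>N\<in>h ` F. R N)"
    using h F(1) R(1) f by (intro sum_mono2) auto
  also have "\<dots> \<le> (\<Sum>N\<in>h ` F. sum f (R N))"
    using F(1) R(1) f by (intro sum_UN_le) auto
  also have "\<dots> \<le> (\<Sum>N\<in>h ` F. c * (1/2) ^ Suc N)"
    by (intro sum_mono R)
  also have "\<dots> = c * (\<Sum>N\<in>h ` F. (1/2) ^ Suc N)"
    by (simp add: sum_distrib_left)
  also have "(\<Sum>N\<in>h ` F. (1/2) ^ Suc N) \<le> (1::real)"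
  proof -
    have "(\<Sum>N\<in>h ` F. (1/2) ^ Suc N) \<le> (\<Sum>N. (1/2::real) ^ Suc N)"
      using F(1) sums_summable[OF power_half_series] by (intro sum_le_suminf) auto
    then show ?thesis using sums_unique[OF power_half_series] by simp
  qed
  finally show ?thesis using \<open>0 \<le> c\<close> by (simp add: mult_left_mono)
qed

text \<open>If the mass series converges, the cost series diverges and \<open>light_step\<close> is
  iterated. If the mass series diverges, the null covers \<open>R N\<close> are added to
  \<open>Q\<close>: the enlarged family still has mass less than that of \<open>v\<close>, and a
  point avoiding it is hit infinitely often.\<close>

lemma light_hit:
  fixes g :: "nat \<Rightarrow> real"
  assumes t: "\<And>n. n \<le> t n"
    and pos: "\<And>n. 0 < g n" and dec: "\<And>m n. m \<le> n \<Longrightarrow> g n \<le> g m"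
    and inc: "\<And>m n. m \<le> n \<Longrightarrow> 2 ^ m * g m \<le> 2 ^ n * g n"
    and ns: "\<not> summable (\<lambda>n. 2 ^ n / 2 ^ t n :: real) \<or> \<not> summable (\<lambda>n. 2 ^ n * g (t n))"
    and lt: "light g Q (1/16) v" and Q: "\<forall>A\<in>Q. \<not> strict_prefix A v"
  obtains x where "x \<in> cantor_set" "\<And>N. \<exists>n\<ge>N. \<exists>D\<in>target t n. x \<in> cyl D"
    "\<And>A. A \<in> Q \<Longrightarrow> x \<notin> cyl A"
proof (cases "summable (\<lambda>n. 2 ^ n / 2 ^ t n :: real)")
  case True
  define P where "P = (\<lambda>v. light g Q (1/16) v \<and> (\<forall>A\<in>Q. \<not> prefix A v))"
  have "v \<notin> Q"
  proof
    assume "v \<in> Q"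
    then have "g (length v) \<le> 1/16 * g (length v)"
      using lt[unfolded light_def, rule_format, of "{v}"] by simp
    then show False using pos[of "length v"] by simp
  qed
  then have "P v" using lt Q by (auto simp: P_def strict_prefix_def)
  moreover have "\<exists>D. prefix v D \<and> length v < length D \<and> P D \<and> (\<exists>n\<ge>N. D \<in> target t n)" if "P v" for v N
    using light_step[of t g Q v N] assms True that unfolding P_def by blast
  ultimately obtain x where x: "x \<in> cantor_set" "x \<in> cyl v"
      "\<And>N. \<exists>D. P D \<and> (\<exists>n\<ge>N. D \<in> target t n) \<and> N < length D \<and> x \<in> cyl D"
    using chain_point[of P v "\<lambda>N D. \<exists>n\<ge>N. D \<in> target t n"] by blast
  show ?thesis
  proof (rule that[OF x(1)])
    show "\<exists>n\<ge>N. \<exists>D\<in>target t n. x \<in> cyl D" for N using x(3)[of N] by blast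
    have "\<exists>D. (\<forall>A\<in>Q. \<not> prefix A D) \<and> n < length D \<and> x \<in> cyl D" for n
      using x(3)[of n] by (auto simp: P_def)
    then show "x \<notin> cyl A" if "A \<in> Q" for A
      using that by (intro not_in_cyl_of_chain[of Q]) auto
  qed
next
  case False
  let ?w = "\<lambda>w::bool list. (1/2::real) ^ length w"
  obtain R where "\<forall>N::nat. finite (R N) \<and> (\<Sum>w\<in>R N. ?w w) \<le> 1/4 * ?w v * (1/2) ^ Suc N \<and>
      (\<forall>x \<in> cantor_set \<inter> cyl v.
         (\<exists>w\<in>R N. x \<in> cyl w) \<or> (\<exists>n\<ge>N. \<exists>D\<in>target t n. x \<in> cyl D))"
    using null_cover_Union[OF t False, of "1/4" v] zero_less_divide_1_iff zero_less_numeral by blast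
  then have R: "finite (R N)" "(\<Sum>w\<in>R N. ?w w) \<le> 1/4 * ?w v * (1/2) ^ Suc N"
      "\<And>x. x \<in> cantor_set \<Longrightarrow> x \<in> cyl v \<Longrightarrow>
          (\<exists>w\<in>R N. x \<in> cyl w) \<or> (\<exists>n\<ge>N. \<exists>D\<in>target t n. x \<in> cyl D)" for N
    by blast+
  have sumR: "(\<Sum>w\<in>F. ?w w) \<le> 1/4 * ?w v" if "finite F" "F \<subseteq> (\<Union>N. R N)" for F
    using sum_le_geometric[of R ?w "1/4 * ?w v" F, OF R(1,2) _ that] by simp
  define Q' where "Q' = Q \<union> (\<Union>N. R N)"
  have "light (\<lambda>n. (1/2) ^ n) Q' (1/2) v"
    unfolding light_def
  proof (intro allI impI)
    fix F assume F: "F \<subseteq> {A \<in> Q'. prefix v A}" "finite F"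
    have "(\<Sum>A\<in>F. ?w A) \<le> (\<Sum>A\<in>(F \<inter> Q) \<union> (F \<inter> (\<Union>N. R N)). ?w A)"
      using F by (intro sum_mono2) (auto simp: Q'_def)
    also have "\<dots> \<le> (\<Sum>A\<in>F \<inter> Q. ?w A) + (\<Sum>A\<in>F \<inter> (\<Union>N. R N). ?w A)"
      using F(2) by (intro sum_Un_le) auto
    also have "(\<Sum>A\<in>F \<inter> (\<Union>N. R N). ?w A) \<le> 1/4 * ?w v"
      using sumR F(2) by simp
    \<comment> \<open>Since \<open>2 ^ n * g n\<close> is nondecreasing, the mass of an extension of
      \<open>v\<close> relative to \<open>v\<close> is at most its relative cost; so cheapness in
      cost passes to mass.\<close>
    also have "(\<Sum>A\<in>F \<inter> Q. ?w A) \<le> 1/16 * ?w v"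
    proof -
      have "(2 ^ length v * g (length v)) * (\<Sum>A\<in>F \<inter> Q. ?w A) =
          (\<Sum>A\<in>F \<inter> Q. (2 ^ length v * g (length v)) * ?w A)"
        by (rule sum_distrib_left)
      also have "\<dots> \<le> (\<Sum>A\<in>F \<inter> Q. g (length A))"
      proof (rule sum_mono)
        fix A assume "A \<in> F \<inter> Q"
        then have "length v \<le> length A" using F(1) prefix_length_le by blast
        from inc[OF this] show "(2 ^ length v * g (length v)) * ?w A \<le> g (length A)"
          by (simp add: power_one_over field_simps)
      qed
      also have "\<dots> \<le> 1/16 * g (length v)"
        using lt F unfolding light_def by blast
      finally have "(2 ^ length v * (\<Sum>A\<in>F \<inter> Q. ?w A)) * g (length v) \<le> 1/16 * g (length v)"
        by (simp add: mult_ac)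
      then have "2 ^ length v * (\<Sum>A\<in>F \<inter> Q. ?w A) \<le> 1/16"
        using pos[of "length v"] by (simp only: mult_le_cancel_right_pos)
      then show ?thesis by (simp add: power_one_over field_simps)
    qed
    finally have "(\<Sum>A\<in>F. ?w A) \<le> 5/16 * ?w v" by simp
    also have "\<dots> \<le> 1/2 * ?w v" by (intro mult_right_mono) auto
    finally show "(\<Sum>A\<in>F. ?w A) \<le> 1/2 * ?w v" .
  qed
  \<comment> \<open>A strict prefix of \<open>v\<close> has more mass than \<open>v\<close>, but all
    \<open>R N\<close> together have at most a quarter of it.\<close>
  moreover have "\<forall>A\<in>Q'. \<not> strict_prefix A v"
  proof
    fix A assume A: "A \<in> Q'"
    show "\<not> strict_prefix A v"
    proof (cases "A \<in> Q")
      case False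
      then have "?w A \<le> 1/4 * ?w v"
        using sumR[of "{A}"] A by (simp add: Q'_def)
      moreover have "0 < ?w v" by simp
      ultimately have "?w A < ?w v" by linarith
      then have "\<not> length A < length v"
        using power_decreasing[of "length A" "length v" "1/2::real"] by auto
      then show ?thesis using prefix_length_less by blast
    qed (use Q in blast)
  qed
  ultimately obtain x where x: "x \<in> cantor_set" "x \<in> cyl v" "\<And>A. A \<in> Q' \<Longrightarrow> x \<notin> cyl A"
    using light_miss[of Q' "1/2" v] by auto
  show ?thesis
  proof (rule that[OF x(1)])
    show "\<exists>n\<ge>N. \<exists>D\<in>target t n. x \<in> cyl D" for N
      using R(3)[OF x(1,2), of N] x(3) by (auto simp: Q'_def)
    show "x \<notin> cyl A" if "A \<in> Q" for A using x(3) that by (simp add: Q'_def)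
  qed
qed

section \<open>Covers and Hausdorff measures\<close>

lemma infsum_ennreal_SUP:
  fixes f :: "'b \<Rightarrow> ennreal"
  shows "infsum f A = (SUP F\<in>{F. finite F \<and> F \<subseteq> A}. sum f F)"
  by (rule nonneg_infsum_complete) simp

lemma hausdorff_premeasure_mono:
  "F \<subseteq> F' \<Longrightarrow> hausdorff_premeasure f \<rho> F \<le> hausdorff_premeasure f \<rho> F'"
  unfolding hausdorff_premeasure_def by (rule INF_superset_mono) (unfold rho_cover_def, blast+)

lemma hausdorff_measure_mono:
  "F \<subseteq> F' \<Longrightarrow> hausdorff_measure f F \<le> hausdorff_measure f F'"
  unfolding hausdorff_measure_def by (intro SUP_mono' hausdorff_premeasure_mono)

lemma hausdorff_measure_eq_0I:
  assumes "\<And>\<rho> e. 0 < \<rho> \<Longrightarrow> 0 < e \<Longrightarrow> hausdorff_premeasure f \<rho> F \<le> ennreal e"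
  shows "hausdorff_measure f F = 0"
proof -
  have "hausdorff_premeasure f \<rho> F \<le> 0" if "0 < \<rho>" for \<rho>
    by (rule ennreal_le_epsilon) (simp add: assms that)
  then have "hausdorff_measure f F \<le> 0"
    unfolding hausdorff_measure_def by (intro SUP_least) simp
  then show ?thesis by simp
qed

lemma infsum_Un_le_ennreal:
  fixes f :: "'b \<Rightarrow> ennreal"
  shows "infsum f (A \<union> B) \<le> infsum f A + infsum f B"
  unfolding infsum_ennreal_SUP[of f "A \<union> B"]
proof (rule SUP_least)
  fix F assume F: "F \<in> {F. finite F \<and> F \<subseteq> A \<union> B}"
  then have "F = (F \<inter> A) \<union> (F \<inter> B)" by blast
  then have "sum f F \<le> sum f (F \<inter> A) + sum f (F \<inter> B)"
    using sum_Un_le[of "F \<inter> A" "F \<inter> B" f] F by simp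
  also have "\<dots> \<le> infsum f A + infsum f B"
    unfolding infsum_ennreal_SUP using F by (intro add_mono SUP_upper) auto
  finally show "sum f F \<le> infsum f A + infsum f B" .
qed

lemma hausdorff_premeasure_Un_le:
  "hausdorff_premeasure f \<rho> (F \<union> F') \<le> hausdorff_premeasure f \<rho> F + hausdorff_premeasure f \<rho> F'"
proof -
  let ?c = "\<lambda>B. \<Sum>\<^sub>\<infinity>(c, r) \<in> B. ennreal (f r)"
  have "hausdorff_premeasure f \<rho> (F \<union> F') \<le> ?c B + ?c B'"
    if "rho_cover \<rho> F B" "rho_cover \<rho> F' B'" for B B'
  proof -
    have "rho_cover \<rho> (F \<union> F') (B \<union> B')" using that by (auto simp: rho_cover_def)
    then have "hausdorff_premeasure f \<rho> (F \<union> F') \<le> ?c (B \<union> B')"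
      unfolding hausdorff_premeasure_def by (intro INF_lower) simp
    also have "\<dots> \<le> ?c B + ?c B'" by (rule infsum_Un_le_ennreal)
    finally show ?thesis .
  qed
  note bound = this
  let ?X = "hausdorff_premeasure f \<rho> F" and ?Y = "hausdorff_premeasure f \<rho> F'"
  show ?thesis
  proof (rule ennreal_le_epsilon)
    fix e :: real assume fin: "?X + ?Y < top" and e: "0 < e"
    have "?X < ?X + ennreal (e / 2)" "?Y < ?Y + ennreal (e / 2)"
      using fin e by (auto simp: ennreal_add_left_cancel_less less_top)
    then obtain B B' where B: "rho_cover \<rho> F B" "?c B < ?X + ennreal (e / 2)"
        and B': "rho_cover \<rho> F' B'" "?c B' < ?Y + ennreal (e / 2)"
      unfolding hausdorff_premeasure_def INF_less_iff by blast
    have "hausdorff_premeasure f \<rho> (F \<union> F') \<le> ?c B + ?c B'" by (rule bound[OF B(1) B'(1)])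
    also have "\<dots> \<le> (?X + ennreal (e / 2)) + (?Y + ennreal (e / 2))"
      using B(2) B'(2) by (intro add_mono less_imp_le)
    also have "\<dots> = ?X + ?Y + (ennreal (e / 2) + ennreal (e / 2))" by (simp only: ac_simps)
    also have "ennreal (e / 2) + ennreal (e / 2) = ennreal e"
      using e by (simp flip: ennreal_plus)
    finally show "hausdorff_premeasure f \<rho> (F \<union> F') \<le> ?X + ?Y + ennreal e" .
  qed
qed

lemma hausdorff_measure_eq_if_null:
  assumes "hausdorff_measure f (K - V) = 0"
  shows "hausdorff_measure f (V \<inter> K) = hausdorff_measure f K"
proof (rule antisym)
  show "hausdorff_measure f K \<le> hausdorff_measure f (V \<inter> K)"
    unfolding hausdorff_measure_def
  proof (rule SUP_mono)
    fix \<rho> :: real assume \<rho>: "\<rho> \<in> {0<..}"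
    have "hausdorff_premeasure f \<rho> (K - V) \<le> hausdorff_measure f (K - V)"
      unfolding hausdorff_measure_def using \<rho> by (intro SUP_upper)
    then have "hausdorff_premeasure f \<rho> (K - V) = 0" using assms by simp
    then have "hausdorff_premeasure f \<rho> K \<le> hausdorff_premeasure f \<rho> (V \<inter> K)"
      using hausdorff_premeasure_Un_le[of f \<rho> "V \<inter> K" "K - V"]
      by (simp add: Int_commute Int_Diff_Un)
    then show "\<exists>\<rho>'\<in>{0<..}. hausdorff_premeasure f \<rho> K \<le> hausdorff_premeasure f \<rho>' (V \<inter> K)"
      using \<rho> by blast
  qed
qed (simp add: hausdorff_measure_mono)

text \<open>A cover is a set of pairs, so a ball occurring in several \<open>B n\<close> is paid for
  once; the series can only be larger.\<close>

lemma hausdorff_premeasure_le: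
  fixes B :: "nat \<Rightarrow> (real \<times> real) set"
  assumes B: "\<And>n. finite (B n)" "\<And>n c r. (c, r) \<in> B n \<Longrightarrow> 0 < r \<and> r \<le> \<rho>"
    and F: "F \<subseteq> (\<Union>n. \<Union>(c, r)\<in>B n. ball c r)"
  shows "hausdorff_premeasure f \<rho> F \<le> (\<Sum>n. \<Sum>(c, r)\<in>B n. ennreal (f r))"
proof -
  have "rho_cover \<rho> F (\<Union>n. B n)"
    unfolding rho_cover_def
  proof (intro conjI)
    show "countable (\<Union>n. B n)"
      by (intro countable_UN[OF countableI_type] countable_finite B)
    show "\<forall>(c, r)\<in>(\<Union>n. B n). 0 < r \<and> r \<le> \<rho>" using B(2) by blast
    show "F \<subseteq> (\<Union>(c, r)\<in>(\<Union>n. B n). ball c r)" using F by blast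
  qed
  then have "hausdorff_premeasure f \<rho> F \<le> (\<Sum>\<^sub>\<infinity>(c, r)\<in>(\<Union>n. B n). ennreal (f r))"
    unfolding hausdorff_premeasure_def by (intro INF_lower) simp
  also have "\<dots> \<le> (\<Sum>n. \<Sum>(c, r)\<in>B n. ennreal (f r))"
    unfolding infsum_ennreal_SUP
  proof (rule SUP_least)
    fix G assume G: "G \<in> {G. finite G \<and> G \<subseteq> (\<Union>n. B n)}"
    then have "\<forall>x\<in>G. \<exists>n. x \<in> B n" by blast
    from bchoice[OF this] obtain h where h: "\<And>x. x \<in> G \<Longrightarrow> x \<in> B (h x)" by blast
    have "(\<Sum>(c, r)\<in>G. ennreal (f r)) \<le> (\<Sum>(c, r)\<in>(\<Union>n\<in>h ` G. B n). ennreal (f r))"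
      using h G B(1) by (intro sum_mono2) auto
    also have "\<dots> \<le> (\<Sum>n\<in>h ` G. \<Sum>(c, r)\<in>B n. ennreal (f r))"
      using G B(1) by (intro sum_UN_le) auto
    also have "\<dots> \<le> (\<Sum>n. \<Sum>(c, r)\<in>B n. ennreal (f r))"
      using G by (intro sum_le_suminf) auto
    finally show "(\<Sum>(c, r)\<in>G. ennreal (f r)) \<le> (\<Sum>n. \<Sum>(c, r)\<in>B n. ennreal (f r))" .
  qed
  finally show ?thesis .
qed

text \<open>Balls are open, so a ball of radius \<open>(1/3) ^ length w\<close> about the left
  endpoint misses the right one; hence the second ball. The two endpoints are also the only
  fractions of that level within distance less than \<open>(1/3) ^ length w\<close> of a point of
  the cylinder, apart from none at all.\<close>

definition end_balls :: "real \<Rightarrow> bool list \<Rightarrow> (real \<times> real) set" where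
  "end_balls s w = (\<lambda>j. ((real_of_int (word_num w) + j) / 3 ^ length w, s)) ` {0, 1}"

lemma end_balls_iff:
  "(c, r) \<in> end_balls s w \<longleftrightarrow> r = s \<and>
     (c = real_of_int (word_num w) / 3 ^ length w \<or> c = (real_of_int (word_num w) + 1) / 3 ^ length w)"
  by (auto simp: end_balls_def)

text \<open>The radius may vary with the word. The two balls per word account for the factor
  2.\<close>

lemma hausdorff_premeasure_le_words:
  assumes R: "\<And>n. finite (R n)" and s: "\<And>n w. w \<in> R n \<Longrightarrow> 0 < s w \<and> s w \<le> \<rho>"
    and f: "\<And>r. 0 < r \<Longrightarrow> 0 \<le> f r"
    and F: "F \<subseteq> (\<Union>n. \<Union>w\<in>R n. \<Union>(c, r)\<in>end_balls (s w) w. ball c r)"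
    and a: "\<And>n. (\<Sum>w\<in>R n. f (s w)) \<le> a n" "summable a"
  shows "hausdorff_premeasure f \<rho> F \<le> ennreal (2 * suminf a)"
proof -
  define B where "B = (\<lambda>n. \<Union>w\<in>R n. end_balls (s w) w)"
  have fin: "finite (end_balls (s w) w)" for w by (simp add: end_balls_def)
  have "hausdorff_premeasure f \<rho> F \<le> (\<Sum>n. \<Sum>(c, r)\<in>B n. ennreal (f r))"
  proof (rule hausdorff_premeasure_le)
    show "finite (B n)" for n using R fin by (simp add: B_def)
    show "0 < r \<and> r \<le> \<rho>" if "(c, r) \<in> B n" for n c r
      using that s by (auto simp: B_def end_balls_iff)
    show "F \<subseteq> (\<Union>n. \<Union>(c, r)\<in>B n. ball c r)"
    proof
      fix x assume "x \<in> F"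
      then obtain n w z where w: "w \<in> R n" "z \<in> end_balls (s w) w" "x \<in> (case z of (c, r) \<Rightarrow> ball c r)"
        using F by blast
      then have "z \<in> B n" by (auto simp: B_def)
      with w(3) show "x \<in> (\<Union>n. \<Union>(c, r)\<in>B n. ball c r)" by blast
    qed
  qed
  also have "\<dots> \<le> (\<Sum>n. ennreal (2 * a n))"
  proof (intro suminf_le summableI)
    fix n
    have "(\<Sum>(c, r)\<in>B n. ennreal (f r)) \<le> (\<Sum>w\<in>R n. \<Sum>(c, r)\<in>end_balls (s w) w. ennreal (f r))"
      unfolding B_def using R fin by (intro sum_UN_le) auto
    also have "\<dots> \<le> (\<Sum>w\<in>R n. ennreal (2 * f (s w)))"
    proof (rule sum_mono)
      fix w assume w: "w \<in> R n"
      have "(\<Sum>(c, r)\<in>end_balls (s w) w. ennreal (f r)) = (\<Sum>x\<in>end_balls (s w) w. ennreal (f (s w)))"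
        by (intro sum.cong) (auto simp: end_balls_def)
      also have "\<dots> = of_nat (card (end_balls (s w) w)) * ennreal (f (s w))" by simp
      also have "\<dots> \<le> of_nat 2 * ennreal (f (s w))"
      proof (rule mult_right_mono)
        have "card (end_balls (s w) w) \<le> card {0, 1 :: real}"
          unfolding end_balls_def by (rule card_image_le) simp
        then show "of_nat (card (end_balls (s w) w)) \<le> (of_nat 2 :: ennreal)"
          by (intro of_nat_mono) simp
      qed simp
      also have "\<dots> = ennreal (2 * f (s w))"
        using f s[OF w] by (simp add: ennreal_mult)
      finally show "(\<Sum>(c, r)\<in>end_balls (s w) w. ennreal (f r)) \<le> ennreal (2 * f (s w))" .
    qed
    also have "\<dots> = ennreal (\<Sum>w\<in>R n. 2 * f (s w))"
      using f s by (intro sum_ennreal) force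
    also have "\<dots> \<le> ennreal (2 * a n)"
      using a(1)[of n] by (intro ennreal_leI) (simp flip: sum_distrib_left)
    finally show "(\<Sum>(c, r)\<in>B n. ennreal (f r)) \<le> ennreal (2 * a n)" .
  qed
  also have "\<dots> = ennreal (2 * suminf a)"
  proof (rule suminf_ennreal_eq)
    show "0 \<le> 2 * a n" for n
    proof -
      have "0 \<le> (\<Sum>w\<in>R n. f (s w))" using f s by (intro sum_nonneg) blast
      then show ?thesis using a(1)[of n] by linarith
    qed
    show "(\<lambda>n. 2 * a n) sums (2 * suminf a)" using a(2) by (intro sums_mult summable_sums)
  qed
  finally show ?thesis .
qed

lemma cyl_subset_end_balls:
  "cyl w \<subseteq> (\<Union>(c, r)\<in>end_balls ((1/3) ^ length w) w. ball c r)"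
proof
  fix x assume "x \<in> cyl w"
  then have x: "real_of_int (word_num w) / 3 ^ length w \<le> x"
      "x \<le> real_of_int (word_num w) / 3 ^ length w + (1/3) ^ length w"
    by (auto simp: cyl_def add_divide_distrib power_one_over)
  show "x \<in> (\<Union>(c, r)\<in>end_balls ((1/3) ^ length w) w. ball c r)"
  proof (cases "x = real_of_int (word_num w) / 3 ^ length w + (1/3) ^ length w")
    case True
    then show ?thesis
      by (auto simp: end_balls_def add_divide_distrib power_one_over)
  next
    case False
    then have "x \<in> ball (real_of_int (word_num w) / 3 ^ length w) ((1/3) ^ length w)"
      using x by (auto simp: dist_real_def)
    then show ?thesis by (auto simp: end_balls_def)
  qed
qed

section \<open>Approximable points, the convergence case and the null complement\<close>

text \<open>For each \<open>n\<close> only finitely many numerators \<open>p\<close> qualify, so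
  infinitely many pairs means infinitely many exponents.\<close>

lemma W_powers_of_3_iff:
  "x \<in> W powers_of_3 \<psi> \<longleftrightarrow>
     x \<in> {0..1} \<and> (\<forall>N. \<exists>n\<ge>N. \<exists>p::int. \<bar>x - p / 3 ^ n\<bar> < \<psi> (3 ^ n))"
proof -
  define H where "H = {(p :: int, q :: nat). q \<in> powers_of_3 \<and> \<bar>x - real_of_int p / real q\<bar> < \<psi> (real q)}"
  have fin: "finite {p::int. \<bar>x - p / 3 ^ n\<bar> < e}" for n e
  proof (rule finite_subset)
    show "{p::int. \<bar>x - p / 3 ^ n\<bar> < e} \<subseteq> {\<lfloor>(x - e) * 3 ^ n\<rfloor>..\<lceil>(x + e) * 3 ^ n\<rceil>}"
    proof
      fix p :: int assume "p \<in> {p::int. \<bar>x - p / 3 ^ n\<bar> < e}"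
      then have "x - e < p / 3 ^ n" "p / 3 ^ n < x + e" by (auto simp: abs_less_iff)
      then have "(x - e) * 3 ^ n < p" "p < (x + e) * 3 ^ n" by (auto simp: field_simps)
      then show "p \<in> {\<lfloor>(x - e) * 3 ^ n\<rfloor>..\<lceil>(x + e) * 3 ^ n\<rceil>}"
        by (auto simp: floor_le_iff le_ceiling_iff)
    qed
  qed simp
  have "infinite H \<longleftrightarrow> (\<forall>N. \<exists>n\<ge>N. \<exists>p::int. \<bar>x - p / 3 ^ n\<bar> < \<psi> (3 ^ n))"
  proof (intro iffI allI)
    fix N assume inf: "infinite H"
    show "\<exists>n\<ge>N. \<exists>p::int. \<bar>x - p / 3 ^ n\<bar> < \<psi> (3 ^ n)"
    proof (rule ccontr)
      assume none: "\<not> ?thesis"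
      have "H \<subseteq> (\<Union>n\<in>{..<N}. {p::int. \<bar>x - p / 3 ^ n\<bar> < \<psi> (3 ^ n)} \<times> {3 ^ n})"
      proof
        fix y assume "y \<in> H"
        then obtain p n where y: "y = (p, 3 ^ n)" "\<bar>x - real_of_int p / 3 ^ n\<bar> < \<psi> (3 ^ n)"
          by (auto simp: H_def powers_of_3_def)
        then have "n < N" using none not_le by blast
        with y show "y \<in> (\<Union>n\<in>{..<N}. {p::int. \<bar>x - p / 3 ^ n\<bar> < \<psi> (3 ^ n)} \<times> {3 ^ n})" by blast
      qed
      moreover have "finite (\<Union>n\<in>{..<N}. {p::int. \<bar>x - p / 3 ^ n\<bar> < \<psi> (3 ^ n)} \<times> {3 ^ n :: nat})"
        using fin by blast
      ultimately show False using inf finite_subset by blast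
    qed
  next
    assume *: "\<forall>N. \<exists>n\<ge>N. \<exists>p::int. \<bar>x - p / 3 ^ n\<bar> < \<psi> (3 ^ n)"
    show "infinite H"
    proof
      assume "finite H"
      then have "finite (snd ` H)" by simp
      then obtain b where b: "\<And>q. q \<in> snd ` H \<Longrightarrow> q \<le> b" using finite_nat_set_iff_bounded_le[of "snd ` H"] by auto
      obtain n and p :: int where n: "n \<ge> b" "\<bar>x - p / 3 ^ n\<bar> < \<psi> (3 ^ n)" using * by blast
      then have "(p, 3 ^ n) \<in> H" by (auto simp: H_def powers_of_3_def)
      then have "3 ^ n \<le> b" using b by force
      moreover have "n < 3 ^ n" by (rule power_gt_expt) simp
      ultimately show False using n(1) by linarith
    qed
  qed
  then show ?thesis by (simp add: W_def H_def)
qed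

lemma in_W_if_hits:
  assumes "x \<in> cantor_set" "\<And>n. n \<le> t n" "\<And>n. (1/3) ^ t n < \<psi> (3 ^ n)"
    and "\<And>N. \<exists>n\<ge>N. \<exists>D\<in>target t n. x \<in> cyl D"
  shows "x \<in> W powers_of_3 \<psi>"
  unfolding W_powers_of_3_iff
proof (intro conjI allI)
  obtain w where "x \<in> cyl w" using assms(1) cantor_set_iff by blast
  then show "x \<in> {0..1}" using cyl_subset_unit by blast
next
  fix N
  obtain n D where n: "n \<ge> N" "D \<in> target t n" "x \<in> cyl D" using assms(4) by blast
  then obtain p :: int where "\<bar>x - p / 3 ^ n\<bar> \<le> (1/3) ^ t n" using target_close assms(2) by blast
  with assms(3)[of n] n(1) show "\<exists>n\<ge>N. \<exists>p::int. \<bar>x - p / 3 ^ n\<bar> < \<psi> (3 ^ n)"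
    by (meson le_less_trans)
qed

text \<open>The cover uses the end balls of all words of length at least \<open>N\<close>, with
  radius capped at \<open>(1/3) ^ n\<close> so that it is below \<open>\<rho>\<close> even where
  \<open>\<psi>\<close> is not small. If the cap acts, the balls cover the whole cylinder; otherwise
  the approximating fraction must be one of the two endpoints.\<close>

lemma hausdorff_measure_W_eq_0:
  assumes \<psi>: "\<And>r. 0 < r \<Longrightarrow> 0 < \<psi> r" and pos: "\<And>r. 0 < r \<Longrightarrow> 0 < f r"
    and mono: "mono_on {0<..} f"
    and sm: "summable (\<lambda>n. f (\<psi> (3 ^ n)) * 2 ^ n)"
  shows "hausdorff_measure f (W powers_of_3 \<psi> \<inter> cantor_set) = 0"
proof (rule hausdorff_measure_eq_0I)
  fix \<rho> e :: real assume \<rho>: "0 < \<rho>" and e: "0 < e"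
  let ?a = "\<lambda>n. f (\<psi> (3 ^ n)) * 2 ^ n"
  obtain N1 where N1: "norm (\<Sum>i. ?a (i + n)) < e / 2" if "N1 \<le> n" for n
    using suminf_exist_split[OF _ sm, of "e / 2"] e by auto
  obtain N2 where N2: "(1/3::real) ^ N2 < \<rho>" using real_arch_pow_inv[OF \<rho>, of "1/3"] by auto
  define N where "N = max N1 N2"
  have N: "(1/3::real) ^ n < \<rho>" if "N \<le> n" for n
  proof -
    have "(1/3::real) ^ n \<le> (1/3) ^ N2"
      using that by (intro power_decreasing) (auto simp: N_def)
    from this N2 show ?thesis by (rule le_less_trans)
  qed
  define s where "s = (\<lambda>w::bool list. min (\<psi> (3 ^ length w)) ((1/3) ^ length w))"
  have "hausdorff_premeasure f \<rho> (W powers_of_3 \<psi> \<inter> cantor_set) \<le> ennreal (2 * (\<Sum>n. ?a (n + N)))"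
  proof (rule hausdorff_premeasure_le_words[where R = "\<lambda>n. {w. length w = n + N}" and s = s])
    show "0 < s w \<and> s w \<le> \<rho>" if "w \<in> {w. length w = n + N}" for n w
      using N[of "length w"] \<psi> that by (auto simp: s_def)
    show "summable (\<lambda>n. ?a (n + N))" using sm by (rule summable_ignore_initial_segment)
    show "(\<Sum>w\<in>{w. length w = n + N}. f (s w)) \<le> ?a (n + N)" for n
    proof -
      have "(\<Sum>w\<in>{w::bool list. length w = n + N}. f (s w)) \<le>
          (\<Sum>w\<in>{w::bool list. length w = n + N}. f (\<psi> (3 ^ (n + N))))"
        using \<psi> by (intro sum_mono mono_onD[OF mono]) (auto simp: s_def)
      also have "\<dots> = ?a (n + N)"
        using card_extensions[of "[]" "n + N"] by simp
      finally show ?thesis .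
    qed
    show "W powers_of_3 \<psi> \<inter> cantor_set \<subseteq>
        (\<Union>n. \<Union>w\<in>{w. length w = n + N}. \<Union>(c, r)\<in>end_balls (s w) w. ball c r)"
    proof
      fix x assume x: "x \<in> W powers_of_3 \<psi> \<inter> cantor_set"
      then have "\<exists>n\<ge>N. \<exists>p::int. \<bar>x - p / 3 ^ n\<bar> < \<psi> (3 ^ n)"
        by (simp add: W_powers_of_3_iff)
      then obtain n and p :: int where n: "N \<le> n" "\<bar>x - p / 3 ^ n\<bar> < \<psi> (3 ^ n)" by blast
      obtain w where w: "length w = n" "x \<in> cyl w" using x by (auto simp: cantor_set_iff)
      have "x \<in> (\<Union>(c, r)\<in>end_balls (s w) w. ball c r)"
      proof (cases "\<psi> (3 ^ n) \<le> (1/3) ^ n")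
        case True
        have "\<bar>x - p / 3 ^ n\<bar> < 1 / 3 ^ n" using n(2) True by (simp add: power_one_over)
        then have "x < (p + 1) / 3 ^ n" "(p - 1) / 3 ^ n < x"
          by (simp_all add: abs_less_iff add_divide_distrib diff_divide_distrib)
        then have "x * 3 ^ n < p + 1" "p - 1 < x * 3 ^ n"
          by (simp_all add: pos_less_divide_eq pos_divide_less_eq)
        moreover have "word_num w \<le> x * 3 ^ n" "x * 3 ^ n \<le> word_num w + 1"
          using w by (auto simp: cyl_def field_simps)
        ultimately have "real_of_int p < word_num w + 2" "word_num w < real_of_int p + 1" by linarith+
        then have "p = word_num w \<or> p = word_num w + 1" by linarith
        then have "(p / 3 ^ n, s w) \<in> end_balls (s w) w" using w by (auto simp: end_balls_iff)
        moreover have "x \<in> ball (p / 3 ^ n) (s w)"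
          using n True w by (simp add: s_def dist_real_def abs_minus_commute)
        ultimately show ?thesis by blast
      next
        case False
        then have "s w = (1/3) ^ length w" using w by (simp add: s_def)
        then show ?thesis using subsetD[OF cyl_subset_end_balls w(2)] by simp
      qed
      moreover have "w \<in> {w. length w = (n - N) + N}" using w n by simp
      ultimately show "x \<in> (\<Union>n. \<Union>w\<in>{w. length w = n + N}. \<Union>(c, r)\<in>end_balls (s w) w. ball c r)"
        by (intro UN_I[of "n - N"] UN_I[of w]) auto
    qed
  qed (use pos in \<open>auto simp: finite_words less_imp_le\<close>)
  also have "\<dots> \<le> ennreal e"
    using N1[of N] by (intro ennreal_leI) (auto simp: N_def)
  finally show "hausdorff_premeasure f \<rho> (W powers_of_3 \<psi> \<inter> cantor_set) \<le> ennreal e" .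
qed

text \<open>A point of the Cantor set outside \<open>W\<close> is no longer hit from some
  \<open>N\<close> on, so the null cover \<open>R N\<close> catches it; the bound \<open>C\<close>
  turns small mass into small cost.\<close>

lemma hausdorff_measure_diff_W_eq_0:
  assumes pos: "\<And>r. 0 < r \<Longrightarrow> 0 < f r" and C: "\<And>k. f ((1/3) ^ k) \<le> C * (1/2) ^ k"
    and t: "\<And>n. n \<le> t n" "\<And>n. (1/3) ^ t n < \<psi> (3 ^ n)"
    and ns: "\<not> summable (\<lambda>n. 2 ^ n / 2 ^ t n :: real)"
  shows "hausdorff_measure f (cantor_set - W powers_of_3 \<psi>) = 0"
proof (rule hausdorff_measure_eq_0I)
  fix \<rho> e :: real assume \<rho>: "0 < \<rho>" and e: "0 < e"
  have "0 < C" using C[of 0] pos[of 1] by simp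
  \<comment> \<open>The bound \<open>d \<le> \<rho>\<close> also limits the radii, because
    \<open>(1/3) ^ k \<le> (1/2) ^ k\<close>; the other bound gives cost
    \<open>2 * C * d \<le> e\<close>.\<close>
  define d where "d = min \<rho> (e / (2 * C))"
  have d: "0 < d" "d \<le> \<rho>" "2 * C * d \<le> e" using \<open>0 < C\<close> \<rho> e by (auto simp: d_def min_def field_simps)
  obtain R where "\<forall>N::nat. finite (R N) \<and>
      (\<Sum>w\<in>R N. (1/2::real) ^ length w) \<le> d * (1/2) ^ length ([] :: bool list) * (1/2) ^ Suc N \<and>
      (\<forall>x \<in> cantor_set \<inter> cyl [].
         (\<exists>w\<in>R N. x \<in> cyl w) \<or> (\<exists>n\<ge>N. \<exists>D\<in>target t n. x \<in> cyl D))"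
    using null_cover_Union[OF t(1) ns d(1), of "[]"] by blast
  then have R: "finite (R N)" "(\<Sum>w\<in>R N. (1/2::real) ^ length w) \<le> d * (1/2) ^ Suc N"
      "\<And>x. x \<in> cantor_set \<Longrightarrow> x \<in> {0..1} \<Longrightarrow>
        (\<exists>w\<in>R N. x \<in> cyl w) \<or> (\<exists>n\<ge>N. \<exists>D\<in>target t n. x \<in> cyl D)" for N
    by simp_all
  have "hausdorff_premeasure f \<rho> (cantor_set - W powers_of_3 \<psi>) \<le>
      ennreal (2 * (\<Sum>N. C * d * (1/2) ^ Suc N))"
  proof (rule hausdorff_premeasure_le_words[where R = R and s = "\<lambda>w. (1/3) ^ length w"])
    show "0 < (1/3::real) ^ length w \<and> (1/3) ^ length w \<le> \<rho>" if w: "w \<in> R N" for N w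
    proof -
      have "(1/3::real) ^ length w \<le> (1/2) ^ length w" by (rule power_mono) auto
      also have "\<dots> \<le> (\<Sum>w\<in>R N. (1/2::real) ^ length w)"
        using w R(1) by (intro member_le_sum) auto
      also have "\<dots> \<le> d * (1/2) ^ Suc N" by (rule R)
      also have "\<dots> \<le> d * 1" using d(1) by (intro mult_left_mono power_le_one) auto
      finally show ?thesis using d by simp
    qed
    show "(\<Sum>w\<in>R N. f ((1/3) ^ length w)) \<le> C * d * (1/2) ^ Suc N" for N
    proof -
      have "(\<Sum>w\<in>R N. f ((1/3) ^ length w)) \<le> (\<Sum>w\<in>R N. C * (1/2) ^ length w)"
        by (intro sum_mono C)
      also have "\<dots> = C * (\<Sum>w\<in>R N. (1/2) ^ length w)" by (simp add: sum_distrib_left)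
      also have "\<dots> \<le> C * (d * (1/2) ^ Suc N)"
        using R(2) \<open>0 < C\<close> by (intro mult_left_mono) auto
      finally show ?thesis by (simp only: mult.assoc)
    qed
    show "summable (\<lambda>N. C * d * (1/2) ^ Suc N)"
      by (intro summable_mult sums_summable[OF power_half_series])
    show "cantor_set - W powers_of_3 \<psi> \<subseteq>
        (\<Union>N. \<Union>w\<in>R N. \<Union>(c, r)\<in>end_balls ((1/3) ^ length w) w. ball c r)"
    proof
      fix x assume x: "x \<in> cantor_set - W powers_of_3 \<psi>"
      then obtain N where N: "\<not> (\<exists>n\<ge>N. \<exists>D\<in>target t n. x \<in> cyl D)"
        using in_W_if_hits[of x t \<psi>] t by blast
      obtain w' where "x \<in> cyl w'" using x cantor_set_iff by blast
      then have "x \<in> {0..1}" using cyl_subset_unit by blast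
      then obtain w where "w \<in> R N" "x \<in> cyl w" using R(3)[of x N] x N by blast
      then show "x \<in> (\<Union>N. \<Union>w\<in>R N. \<Union>(c, r)\<in>end_balls ((1/3) ^ length w) w. ball c r)"
        using subsetD[OF cyl_subset_end_balls] by (intro UN_I[of N] UN_I[of w]) auto
    qed
  qed (use pos R(1) in \<open>auto simp: less_imp_le\<close>)
  also have "(\<Sum>N. C * d * (1/2) ^ Suc N) = C * d"
    using sums_unique[OF sums_mult[OF power_half_series, of "C * d"]] by simp
  also have "ennreal (2 * (C * d)) \<le> ennreal e"
    using d(3) by (intro ennreal_leI) (simp add: mult.assoc)
  finally show "hausdorff_premeasure f \<rho> (cantor_set - W powers_of_3 \<psi>) \<le> ennreal e" .
qed

section \<open>A lower bound for the premeasure\<close>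

lemma ex_level:
  assumes "0 < r" "r \<le> (1::real)"
  shows "\<exists>a. (1/3) ^ Suc a < r \<and> r \<le> (1/3) ^ a"
proof -
  obtain n where n: "(1/3::real) ^ n < r" using real_arch_pow_inv[OF assms(1), of "1/3"] by auto
  define m where "m = (LEAST n. (1/3::real) ^ n < r)"
  have m: "(1/3::real) ^ m < r" unfolding m_def using n by (rule LeastI)
  then have "m \<noteq> 0" using assms(2) by (intro notI) simp
  then obtain a where a: "m = Suc a" using not0_implies_Suc by blast
  then have "\<not> (1/3::real) ^ a < r" using not_less_Least[of a "\<lambda>n. (1/3::real) ^ n < r"] m_def by simp
  with m a show ?thesis by (auto simp: not_less)
qed

text \<open>The integer of a word whose cylinder meets the ball lies strictly between
  \<open>b\<close> and \<open>b + 3\<close>, and it determines the word.\<close>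

lemma card_words_meeting_ball:
  assumes "r \<le> (1/3) ^ a"
  shows "card {w. length w = a \<and> cyl w \<inter> ball c r \<noteq> {}} \<le> 3"
proof -
  let ?S = "{w. length w = a \<and> cyl w \<inter> ball c r \<noteq> {}}"
  define b where "b = c * 3 ^ a - 2"
  have "inj_on word_num ?S"
  proof (rule inj_onI)
    fix u w assume u: "u \<in> ?S" and w: "w \<in> ?S" and eq: "word_num u = word_num w"
    then obtain x where "x \<in> cyl u" by blast
    moreover from this have "x \<in> cyl w" using u w eq by (simp add: cyl_def)
    ultimately show "u = w" using u w cyl_eq_length[of u w x] by simp
  qed
  moreover have "word_num ` ?S \<subseteq> {\<lfloor>b\<rfloor> + 1..\<lfloor>b\<rfloor> + 3}"
  proof
    fix z assume "z \<in> word_num ` ?S"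
    then obtain w x where w: "z = word_num w" "length w = a" "x \<in> cyl w" "x \<in> ball c r" by blast
    have "x - c < (1/3) ^ a" "c - x < (1/3) ^ a"
      using w(4) assms by (auto simp: dist_real_def abs_if split: if_splits)
    then have "(x - c) * 3 ^ a < 1" "(c - x) * 3 ^ a < 1"
      by (auto simp: power_one_over pos_less_divide_eq)
    moreover have "z \<le> x * 3 ^ a" "x * 3 ^ a \<le> z + 1"
      using w by (auto simp: cyl_def field_simps)
    ultimately have "b < z" "z < b + 3" by (auto simp: b_def algebra_simps)
    then show "z \<in> {\<lfloor>b\<rfloor> + 1..\<lfloor>b\<rfloor> + 3}" by (auto, linarith+)
  qed
  ultimately have "card ?S \<le> card {\<lfloor>b\<rfloor> + 1..\<lfloor>b\<rfloor> + 3}"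
    by (intro card_inj_on_le) auto
  then show ?thesis by simp
qed

text \<open>A cheaper cover is replaced by cylinders: at most three per ball, each costing at most
  twice the ball. This factor 6 and the threshold 1/16 for lightness give 96. Some word of length
  \<open>k\<close> is then light, and \<open>light_hit\<close> yields a point that the cover
  misses.\<close>

lemma hausdorff_premeasure_W_ge:
  assumes pos: "\<And>r. 0 < r \<Longrightarrow> 0 < f r" and mono: "mono_on {0<..} f"
    and inc: "\<And>m n. m \<le> n \<Longrightarrow> 2 ^ m * f ((1/3) ^ m) \<le> 2 ^ n * f ((1/3) ^ n)"
    and t: "\<And>n. n \<le> t n" "\<And>n. (1/3) ^ t n < \<psi> (3 ^ n)"
    and ns: "\<not> summable (\<lambda>n. 2 ^ n / 2 ^ t n :: real) \<or> \<not> summable (\<lambda>n. 2 ^ n * f ((1/3) ^ t n))"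
  shows "ennreal (2 ^ k * f ((1/3) ^ k) / 96) \<le>
           hausdorff_premeasure f ((1/3) ^ k) (W powers_of_3 \<psi> \<inter> cantor_set)"
  unfolding hausdorff_premeasure_def
proof (rule INF_greatest, rule ccontr)
  fix B assume "B \<in> {B. rho_cover ((1/3) ^ k) (W powers_of_3 \<psi> \<inter> cantor_set) B}"
  then have B: "rho_cover ((1/3) ^ k) (W powers_of_3 \<psi> \<inter> cantor_set) B" by simp
  have r: "0 < r" "r \<le> (1/3) ^ k" "r \<le> 1" if "(c, r) \<in> B" for c r
  proof -
    show "0 < r" "r \<le> (1/3) ^ k" using B that by (auto simp: rho_cover_def)
    moreover have "(1/3::real) ^ k \<le> 1" by (intro power_le_one) auto
    ultimately show "r \<le> 1" by linarith
  qed
  define g where "g = (\<lambda>n. f ((1/3) ^ n))"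
  define u where "u = 2 ^ k * g k"
  have gpos: "0 < g n" for n using pos by (simp add: g_def)
  have gdec: "g n \<le> g m" if "m \<le> n" for m n
    unfolding g_def using that by (intro mono_onD[OF mono] power_decreasing) auto
  assume "\<not> ennreal (2 ^ k * f ((1/3) ^ k) / 96) \<le> (\<Sum>\<^sub>\<infinity>(c, r)\<in>B. ennreal (f r))"
  then have less: "(\<Sum>\<^sub>\<infinity>(c, r)\<in>B. ennreal (f r)) < ennreal (u / 96)"
    by (simp add: u_def g_def not_le)
  have fin_less: "(\<Sum>(c, r)\<in>H. f r) < u / 96" if H: "finite H" "H \<subseteq> B" for H
  proof -
    have f0: "0 \<le> (case z of (c, r) \<Rightarrow> f r)" if "z \<in> H" for z
    proof -
      obtain c r' where z: "z = (c, r')" by fastforce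
      then have "0 < f r'" using that H(2) r(1)[of c r'] by (intro pos) blast
      with z show ?thesis by simp
    qed
    have "ennreal (\<Sum>(c, r)\<in>H. f r) = (\<Sum>z\<in>H. ennreal (case z of (c, r) \<Rightarrow> f r))"
      by (rule sum_ennreal[symmetric]) (rule f0)
    also have "\<dots> = (\<Sum>(c, r)\<in>H. ennreal (f r))" by (simp add: case_prod_beta)
    also have "\<dots> \<le> (\<Sum>\<^sub>\<infinity>(c, r)\<in>B. ennreal (f r))"
      unfolding infsum_ennreal_SUP using H by (intro SUP_upper) auto
    also note less
    finally show ?thesis by (subst (asm) ennreal_less_iff) (auto intro: sum_nonneg f0)
  qed
  have "\<forall>z\<in>B. \<exists>a. (1/3) ^ Suc a < snd z \<and> snd z \<le> (1/3) ^ a"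
    using r ex_level by auto
  from bchoice[OF this] obtain lev where
    lev: "\<And>z. z \<in> B \<Longrightarrow> (1/3) ^ Suc (lev z) < snd z" "\<And>z. z \<in> B \<Longrightarrow> snd z \<le> (1/3) ^ lev z"
    by blast
  define M where "M = (\<lambda>z. {w. length w = lev z \<and> cyl w \<inter> ball (fst z) (snd z) \<noteq> {}})"
  have finM: "finite (M z)" for z
    by (rule finite_subset[OF _ finite_words[of "lev z"]]) (auto simp: M_def)
  have cardM: "card (M z) \<le> 3" if "z \<in> B" for z
    unfolding M_def using lev(2)[OF that] by (rule card_words_meeting_ball)
  \<comment> \<open>Growth of \<open>2 ^ n * g n\<close> between consecutive levels bounds
    \<open>g\<close> at one level by twice its value at the next, which is at most the cost of the
    ball.\<close>
  have g_le: "g (lev z) \<le> 2 * f (snd z)" if z: "z \<in> B" for z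
  proof -
    have "2 ^ lev z * g (lev z) \<le> 2 ^ Suc (lev z) * g (Suc (lev z))"
      unfolding g_def by (rule inc) simp
    then have "g (lev z) \<le> 2 * g (Suc (lev z))" by simp
    also have "g (Suc (lev z)) \<le> f (snd z)"
      unfolding g_def using lev(1)[OF z] r(1)[of "fst z" "snd z"] z
      by (intro mono_onD[OF mono]) auto
    finally show ?thesis by simp
  qed
  define Q where "Q = (\<Union>z\<in>B. M z)"
  have cost: "(\<Sum>w\<in>F. g (length w)) \<le> u / 16" if F: "finite F" "F \<subseteq> Q" for F
  proof -
    have "\<forall>w\<in>F. \<exists>z. z \<in> B \<and> w \<in> M z" using F(2) unfolding Q_def by blast
    from bchoice[OF this] obtain z where z: "\<And>w. w \<in> F \<Longrightarrow> z w \<in> B" "\<And>w. w \<in> F \<Longrightarrow> w \<in> M (z w)"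
      by blast
    have "(\<Sum>w\<in>F. g (length w)) \<le> (\<Sum>w\<in>(\<Union>z\<in>z ` F. M z). g (length w))"
      using F(1) finM gpos z by (intro sum_mono2) (auto simp: less_imp_le)
    also have "\<dots> \<le> (\<Sum>z\<in>z ` F. \<Sum>w\<in>M z. g (length w))"
      using F(1) finM gpos by (intro sum_UN_le) (auto simp: less_imp_le)
    also have "\<dots> \<le> (\<Sum>z\<in>z ` F. 6 * f (snd z))"
    proof (rule sum_mono)
      fix y assume "y \<in> z ` F"
      then have y: "y \<in> B" using z by blast
      have "(\<Sum>w\<in>M y. g (length w)) = real (card (M y)) * g (lev y)"
        by (simp add: M_def)
      also have "\<dots> \<le> 3 * (2 * f (snd y))"
        using cardM[OF y] g_le[OF y] gpos by (intro mult_mono) (auto simp: less_imp_le)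
      finally show "(\<Sum>w\<in>M y. g (length w)) \<le> 6 * f (snd y)" by simp
    qed
    also have "\<dots> = 6 * (\<Sum>(c, r)\<in>z ` F. f r)"
      by (simp add: sum_distrib_left case_prod_beta)
    also have "\<dots> \<le> 6 * (u / 96)"
      using fin_less[of "z ` F"] F(1) z by (intro mult_left_mono less_imp_le) auto
    finally show ?thesis by simp
  qed
  have "\<exists>v. length v = k \<and> light g Q (1/16) v"
  proof (rule ccontr)
    assume none: "\<not> ?thesis"
    \<comment> \<open>The constant at the root is chosen so that the right side is
      \<open>u / 16\<close>; the \<open>2 ^ k\<close> words on the left also add up to
      \<open>u / 16\<close>.\<close>
    have "(\<Sum>D\<in>{v::bool list. length v = k}. 1/16 * g (length D)) < (u / (16 * g 0)) * g (length ([] :: bool list))"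
    proof (rule sum_not_light_less[where Q = Q])
      show "light g Q (u / (16 * g 0)) []"
        unfolding light_def using cost gpos[of 0] by auto
      show "{v::bool list. length v = k} \<noteq> {}" using Ex_list_of_length by blast
      show "D = D'" if "D \<in> {v. length v = k}" "D' \<in> {v. length v = k}" "prefix D D'" for D D' :: "bool list"
        using that by (auto simp: prefix_def)
    qed (use none finite_words in auto)
    moreover have "(\<Sum>D\<in>{v::bool list. length v = k}. 1/16 * g (length D)) = u / 16"
      using card_extensions[of "[]" k] by (simp add: u_def)
    ultimately show False using gpos[of 0] by simp
  qed
  then obtain v where v: "length v = k" "light g Q (1/16) v" by blast
  \<comment> \<open>Radii are at most \<open>(1/3) ^ k\<close>, so every ball has level at least
    \<open>k\<close> and no word of \<open>Q\<close> is shorter than \<open>v\<close>.\<close>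
  have "\<forall>A\<in>Q. \<not> strict_prefix A v"
  proof
    fix A assume "A \<in> Q"
    then obtain z where z: "z \<in> B" "length A = lev z" unfolding Q_def M_def by blast
    then have "(1/3::real) ^ Suc (lev z) < (1/3) ^ k"
      using lev(1)[of z] r(2)[of "fst z" "snd z"] by simp
    moreover have "(1/3::real) ^ k \<le> (1/3) ^ Suc (lev z)" if "Suc (lev z) \<le> k"
      using that by (intro power_decreasing) auto
    ultimately have "\<not> Suc (lev z) \<le> k" by linarith
    then show "\<not> strict_prefix A v" using z v prefix_length_less[of A v] by auto
  qed
  then obtain x where x: "x \<in> cantor_set" "\<And>N. \<exists>n\<ge>N. \<exists>D\<in>target t n. x \<in> cyl D"
      "\<And>A. A \<in> Q \<Longrightarrow> x \<notin> cyl A"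
    using light_hit[of t g Q v] t(1) gpos gdec inc ns v(2) unfolding g_def by blast
  then have "x \<in> W powers_of_3 \<psi> \<inter> cantor_set" using in_W_if_hits[of x t \<psi>] t by blast
  then obtain z where z: "z \<in> B" "x \<in> ball (fst z) (snd z)"
    using B unfolding rho_cover_def case_prod_beta by blast
  obtain w where w: "length w = lev z" "x \<in> cyl w" using x(1) cantor_set_iff by blast
  then have "w \<in> Q" using z unfolding Q_def M_def by blast
  then show False using x(3) w by blast
qed

section \<open>The dichotomy\<close>

lemma third_power_powr_cantor_dim: "((1/3) ^ k) powr (- cantor_dim) = 2 ^ k"
proof -
  have "ln (((1/3::real) ^ k) powr (- cantor_dim)) = ln (2 ^ k)"
    by (simp add: ln_powr ln_realpow ln_div cantor_dim_def)
  then show ?thesis by (subst (asm) ln_inj_iff) auto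
qed

lemma power_3_powr_cantor_dim: "(3 ^ k) powr cantor_dim = 2 ^ k"
proof -
  have "ln ((3 ^ k) powr cantor_dim) = ln (2 ^ k :: real)"
    by (simp add: ln_powr ln_realpow cantor_dim_def)
  then show ?thesis by (subst (asm) ln_inj_iff) auto
qed

theorem theorem1:
  fixes \<psi> f :: "real \<Rightarrow> real"
  assumes "\<And>r. r > 0 \<Longrightarrow> \<psi> r > 0"
    and "dimension_function f"
    and "mono_on {0<..} (\<lambda>r. r powr (- cantor_dim) * f r) \<or>
         antimono_on {0<..} (\<lambda>r. r powr (- cantor_dim) * f r)"
  shows "((\<Sum>n. ennreal (f (\<psi> (3 ^ Suc n)) * (3 ^ Suc n) powr cantor_dim)) < \<infinity> \<longrightarrow>
            hausdorff_measure f (W powers_of_3 \<psi> \<inter> cantor_set) = 0) \<and>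
         ((\<Sum>n. ennreal (f (\<psi> (3 ^ Suc n)) * (3 ^ Suc n) powr cantor_dim)) = \<infinity> \<longrightarrow>
            hausdorff_measure f (W powers_of_3 \<psi> \<inter> cantor_set) = hausdorff_measure f cantor_set)"
proof -
  have pos: "0 < f r" if "0 < r" for r using assms(2) that by (simp add: dimension_function_def)
  have mono: "mono_on {0<..} f" using assms(2) by (simp add: dimension_function_def)
  \<comment> \<open>The factor \<open>(3 ^ n) powr cantor_dim\<close> is \<open>2 ^ n\<close>.
    Indices here start at 0, those of the series at 1, which does not affect summability.\<close>
  define a where "a = (\<lambda>n. f (\<psi> (3 ^ n)) * 2 ^ n)"
  have a0: "0 \<le> a n" for n using pos assms(1) by (simp add: a_def less_imp_le)
  have series: "(\<Sum>n. ennreal (f (\<psi> (3 ^ Suc n)) * (3 ^ Suc n) powr cantor_dim)) =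
      (\<Sum>n. ennreal (a (Suc n)))"
    unfolding a_def power_3_powr_cantor_dim ..
  show ?thesis
    unfolding series
  proof (intro conjI impI)
    assume "(\<Sum>n. ennreal (a (Suc n))) < \<infinity>"
    then have "summable (\<lambda>n. a (Suc n))" by (intro summable_suminf_not_top a0) auto
    then have "summable a" by (simp only: summable_Suc_iff)
    then show "hausdorff_measure f (W powers_of_3 \<psi> \<inter> cantor_set) = 0"
      unfolding a_def using assms(1) pos mono by (intro hausdorff_measure_W_eq_0)
  next
    assume inf: "(\<Sum>n. ennreal (a (Suc n))) = \<infinity>"
    have ns: "\<not> summable a"
    proof
      assume "summable a"
      then have "summable (\<lambda>n. a (Suc n))" by (simp only: summable_Suc_iff)
      then show False using ennreal_suminf_neq_top[of "\<lambda>n. a (Suc n)"] a0 inf by simp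
    qed
    \<comment> \<open>The condition \<open>n \<le> m\<close> is there because a target contains its
      first \<open>n\<close> digits; \<open>t n = n\<close> exactly when
      \<open>(1/3) ^ n < \<psi> (3 ^ n)\<close>.\<close>
    define t where "t = (\<lambda>n. LEAST m. n \<le> m \<and> (1/3) ^ m < \<psi> (3 ^ n))"
    have ex: "\<exists>m\<ge>n. (1/3) ^ m < \<psi> (3 ^ n)" for n
    proof -
      obtain m where m: "(1/3) ^ m < \<psi> (3 ^ n)"
        using real_arch_pow_inv[of "\<psi> (3 ^ n)" "1/3"] assms(1) by auto
      have "(1/3::real) ^ max n m \<le> (1/3) ^ m" by (intro power_decreasing) auto
      from this m have "(1/3) ^ max n m < \<psi> (3 ^ n)" by (rule le_less_trans)
      then show ?thesis by (intro exI[of _ "max n m"]) auto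
    qed
    have t: "n \<le> t n" "(1/3) ^ t n < \<psi> (3 ^ n)" for n
      using LeastI_ex[OF ex[of n]] by (auto simp: t_def)
    define g where "g = (\<lambda>n. f ((1/3) ^ n))"
    have gpos: "0 < g n" for n using pos by (simp add: g_def)
    have a_le: "a n \<le> 2 ^ n * g (t n - 1)" if "n < t n" for n
    proof -
      have "t n - 1 < t n" using that by simp
      then have "\<not> (n \<le> t n - 1 \<and> (1/3) ^ (t n - 1) < \<psi> (3 ^ n))"
        unfolding t_def by (rule not_less_Least)
      then have "\<psi> (3 ^ n) \<le> (1/3) ^ (t n - 1)" using that by auto
      then have "f (\<psi> (3 ^ n)) \<le> g (t n - 1)"
        unfolding g_def using assms(1) by (intro mono_onD[OF mono]) auto
      then show ?thesis by (simp add: a_def)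
    qed
    \<comment> \<open>A term with \<open>t n = n\<close> of the mass series is 1, so convergence
      forces \<open>n < t n\<close> eventually; from there on \<open>a_le\<close> makes
      \<open>h\<close> dominate the divergent series.\<close>
    have not_summable: "\<not> summable h"
      if sm: "summable (\<lambda>n. 2 ^ n / 2 ^ t n :: real)"
        and h: "\<And>n. n < t n \<Longrightarrow> 2 ^ n * g (t n - 1) \<le> h n" for h
    proof
      assume "summable h"
      have "(\<lambda>n. 2 ^ n / 2 ^ t n :: real) \<longlonglongrightarrow> 0" using sm by (rule summable_LIMSEQ_zero)
      then have "eventually (\<lambda>n. 2 ^ n / 2 ^ t n < (1::real)) sequentially"
        by (rule order_tendstoD) simp
      then have "eventually (\<lambda>n. norm (a n) \<le> h n) sequentially"
      proof eventually_elim
        case (elim n)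
        then have "n \<noteq> t n" by (intro notI) simp
        then have "n < t n" using t(1)[of n] by linarith
        then show ?case using a_le h a0[of n] order_trans by fastforce
      qed
      then have "summable a" using \<open>summable h\<close> by (rule summable_comparison_test_ev)
      with ns show False by simp
    qed
    show "hausdorff_measure f (W powers_of_3 \<psi> \<inter> cantor_set) = hausdorff_measure f cantor_set"
    \<comment> \<open>Boundedness of \<open>2 ^ k * g k\<close> says that \<open>f\<close> is at
      most of order \<open>r powr cantor_dim\<close> along \<open>r = (1/3) ^ k\<close>; then the
      complement of \<open>W\<close> in the Cantor set is null.\<close>
    proof (cases "\<exists>C. \<forall>k. 2 ^ k * g k \<le> C")
      case True
      then obtain C where "2 ^ k * g k \<le> C" for k by blast
      then have C: "g k \<le> C * (1/2) ^ k" for k by (simp add: power_one_over field_simps)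
      have "\<not> summable (\<lambda>n. 2 ^ n / 2 ^ t n :: real)"
      proof
        assume sm: "summable (\<lambda>n. 2 ^ n / 2 ^ t n :: real)"
        have "\<not> summable (\<lambda>n. 2 * C * (2 ^ n / 2 ^ t n))"
        proof (rule not_summable[OF sm])
          fix n assume "n < t n"
          then obtain m where m: "t n = Suc m" by (cases "t n") auto
          have "2 ^ n * g m \<le> 2 ^ n * (C * (1/2) ^ m)" by (intro mult_left_mono C) auto
          also have "\<dots> = 2 * C * (2 ^ n / 2 ^ t n)" by (simp add: m power_one_over)
          finally show "2 ^ n * g (t n - 1) \<le> 2 * C * (2 ^ n / 2 ^ t n)" by (simp add: m)
        qed
        with summable_mult[OF sm, of "2 * C"] show False by blast
      qed
      then have "hausdorff_measure f (cantor_set - W powers_of_3 \<psi>) = 0"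
        using pos C t unfolding g_def by (intro hausdorff_measure_diff_W_eq_0)
      then show ?thesis by (rule hausdorff_measure_eq_if_null)
    next
      case False
      have ug: "((1/3) ^ k) powr (- cantor_dim) * f ((1/3) ^ k) = 2 ^ k * g k" for k
        by (simp only: third_power_powr_cantor_dim g_def)
      \<comment> \<open>A nondecreasing quotient would be bounded on radii up to 1 by its value at
        1.\<close>
      have "\<not> mono_on {0<..} (\<lambda>r. r powr (- cantor_dim) * f r)"
      proof
        assume *: "mono_on {0<..} (\<lambda>r. r powr (- cantor_dim) * f r)"
        have "2 ^ k * g k \<le> 2 ^ 0 * g 0" for k
          unfolding ug[symmetric] by (rule mono_onD[OF *]) (auto simp: power_le_one)
        with False show False by blast
      qed
      then have anti: "antimono_on {0<..} (\<lambda>r. r powr (- cantor_dim) * f r)" using assms(3) by blast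
      have inc: "2 ^ m * g m \<le> 2 ^ n * g n" if "m \<le> n" for m n
      proof -
        have "(1/3::real) ^ n \<le> (1/3) ^ m" using that by (intro power_decreasing) auto
        from monotone_onD[OF anti _ _ this] show ?thesis by (simp only: ug) simp
      qed
      \<comment> \<open>Passing from \<open>g (t n - 1)\<close> to \<open>g (t n)\<close> costs at
        most a factor 2, so if the mass series converges, the cost series inherits the divergence of
        \<open>a\<close>.\<close>
      have ns': "\<not> summable (\<lambda>n. 2 ^ n / 2 ^ t n :: real) \<or> \<not> summable (\<lambda>n. 2 ^ n * g (t n))"
      proof (rule disjCI)
        assume "\<not> \<not> summable (\<lambda>n. 2 ^ n * g (t n))"
        then have sm: "summable (\<lambda>n. 2 * (2 ^ n * g (t n)))" by (intro summable_mult) simp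
        show "\<not> summable (\<lambda>n. 2 ^ n / 2 ^ t n :: real)"
        proof
          assume "summable (\<lambda>n. 2 ^ n / 2 ^ t n :: real)"
          then have "\<not> summable (\<lambda>n. 2 * (2 ^ n * g (t n)))"
          proof (rule not_summable)
            fix n assume "n < t n"
            then obtain m where m: "t n = Suc m" by (cases "t n") auto
            have "g m \<le> 2 * g (Suc m)" using inc[of m "Suc m"] by simp
            then show "2 ^ n * g (t n - 1) \<le> 2 * (2 ^ n * g (t n))" by (simp add: m)
          qed
          with sm show False by simp
        qed
      qed
      \<comment> \<open>Both measures are infinite: the premeasures at scale
        \<open>(1/3) ^ k\<close> are at least \<open>2 ^ k * g k / 96\<close>, which is unbounded in
        \<open>k\<close>.\<close>
      have "hausdorff_measure f (W powers_of_3 \<psi> \<inter> cantor_set) = \<infinity>"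
      proof (rule ccontr)
        assume "\<not> ?thesis"
        then obtain y where y: "hausdorff_measure f (W powers_of_3 \<psi> \<inter> cantor_set) = ennreal y" "0 \<le> y"
          by (cases "hausdorff_measure f (W powers_of_3 \<psi> \<inter> cantor_set)" rule: ennreal_cases) auto
        have "2 ^ k * g k \<le> 96 * y" for k
        proof -
          have "ennreal (2 ^ k * g k / 96) \<le> hausdorff_premeasure f ((1/3) ^ k) (W powers_of_3 \<psi> \<inter> cantor_set)"
            using pos mono inc t ns' unfolding g_def by (intro hausdorff_premeasure_W_ge)
          also have "\<dots> \<le> hausdorff_measure f (W powers_of_3 \<psi> \<inter> cantor_set)"
            unfolding hausdorff_measure_def by (intro SUP_upper) simp
          finally show ?thesis using y by (simp add: ennreal_le_iff)
        qed
        with False show False by blast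
      qed
      moreover have "hausdorff_measure f (W powers_of_3 \<psi> \<inter> cantor_set) \<le> hausdorff_measure f cantor_set"
        by (intro hausdorff_measure_mono) blast
      ultimately show ?thesis by (simp add: top_unique)
    qed
  qed
qed

end
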